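(* Let $X$ be a non-empty proper subset of $\mathbb{N}$ and let $M(X)$ be the monoid defined by the presentation $$\langle a,b,c,d,e \mid ab^ic=ab^id\ (i\in X),\quad ab^jc=ab^je\ (j\in\mathbb{N}\setminus X)\rangle.$$ Then the word problem for $M(X)$ is linear-time Turing equivalent to the membership problem for $X$ in unary coding. In particular, the word problem for $M(X)$ is decidable if and only if $X$ is a recursive subset of $\mathbb{N}$.
   Context: $\mathbb{N}$ includes $0$. The word problem for $M(X)$ is the problem of deciding, given two words over $\{a,b,c,d,e\}$, whether they represent the same element of $M(X)$. The membership problem for $X$ in unary coding is the problem of deciding, given $n\in\mathbb{N}$ written in unary, whether $n\in X$. Two problems are linear-time Turing equivalent if each can be solved by an algorithm running in linear time with access to an oracle for the other. *)

theory Defs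
  imports Main "HOL-Algebra.Group"
begin

section \<open>Monoid presentations\<close>

inductive pres_eq :: "('g list \<times> 'g list) set \<Rightarrow> 'g list \<Rightarrow> 'g list \<Rightarrow> bool"
  for R :: "('g list \<times> 'g list) set" where
  rel: "(u, v) \<in> R \<Longrightarrow> pres_eq R u v"
| refl: "pres_eq R u u"
| sym: "pres_eq R u v \<Longrightarrow> pres_eq R v u"
| trans: "pres_eq R u v \<Longrightarrow> pres_eq R v w \<Longrightarrow> pres_eq R u w"
| mult: "pres_eq R u v \<Longrightarrow> pres_eq R u' v' \<Longrightarrow> pres_eq R (u @ u') (v @ v')"

definition pres_congruence :: "('g list \<times> 'g list) set \<Rightarrow> ('g list \<times> 'g list) set" where
  "pres_congruence R = {(u, v). pres_eq R u v}"

definition word_class :: "('g list \<times> 'g list) set \<Rightarrow> 'g list \<Rightarrow> 'g list set" where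
  "word_class R w = pres_congruence R `` {w}"

text \<open>The generating set of the presentation is the whole type of generators.\<close>

definition presented_monoid :: "('g list \<times> 'g list) set \<Rightarrow> 'g list set monoid" where
  "presented_monoid R =
     \<lparr> carrier = UNIV // pres_congruence R,
       mult = (\<lambda>U V. \<Union>u\<in>U. \<Union>v\<in>V. word_class R (u @ v)),
       one = word_class R [] \<rparr>"

lemma equiv_pres_congruence: "equiv UNIV (pres_congruence R)"
proof (rule equivI)
  show "pres_congruence R \<subseteq> UNIV \<times> UNIV"
    by simp
  show "refl_on UNIV (pres_congruence R)"
    by (simp add: refl_on_def pres_congruence_def pres_eq.refl)
  show "sym (pres_congruence R)"
    unfolding sym_def pres_congruence_def by (blast intro: pres_eq.sym)
  show "trans (pres_congruence R)"
    unfolding trans_def pres_congruence_def by (blast intro: pres_eq.trans)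
qed

lemma word_class_eq_iff: "word_class R u = word_class R v \<longleftrightarrow> pres_eq R u v"
  unfolding word_class_def
  using eq_equiv_class_iff[OF equiv_pres_congruence, of u v R]
  by (simp add: pres_congruence_def)

lemma mult_word_class:
  "word_class R u \<otimes>\<^bsub>presented_monoid R\<^esub> word_class R v = word_class R (u @ v)"
proof -
  have "word_class R (u' @ v') = word_class R (u @ v)"
    if "u' \<in> word_class R u" "v' \<in> word_class R v" for u' v'
  proof -
    have "pres_eq R u u'" "pres_eq R v v'"
      using that by (simp_all add: word_class_def pres_congruence_def)
    then show ?thesis
      unfolding word_class_eq_iff by (rule pres_eq.sym[OF pres_eq.mult])
  qed
  then have "(\<Union>u'\<in>word_class R u. \<Union>v'\<in>word_class R v. word_class R (u' @ v')) =
      (\<Union>u'\<in>word_class R u. \<Union>v'\<in>word_class R v. word_class R (u @ v))"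
    by (intro SUP_cong HOL.refl)
  moreover have "u \<in> word_class R u" "v \<in> word_class R v"
    by (simp_all add: word_class_def pres_congruence_def pres_eq.refl)
  ultimately show ?thesis
    unfolding presented_monoid_def monoid.simps by blast
qed

lemma carrier_presented_monoid: "carrier (presented_monoid R) = range (word_class R)"
  by (auto simp: presented_monoid_def quotient_def word_class_def)

lemma monoid_presented_monoid: "monoid (presented_monoid R)"
proof -
  have one: "\<one>\<^bsub>presented_monoid R\<^esub> = word_class R []"
    by (simp add: presented_monoid_def)
  show ?thesis
    by (rule monoidI; unfold carrier_presented_monoid one; (elim rangeE)?;
        simp only: mult_word_class append_assoc append_Nil append_Nil2 rangeI)
qed


section \<open>The monoid $M(X)$\<close>

datatype gen = ga | gb | gc | gd | ge

definition M_relations :: "nat set \<Rightarrow> (gen list \<times> gen list) set" where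
  "M_relations X =
     {([ga] @ replicate i gb @ [gc], [ga] @ replicate i gb @ [gd]) | i. i \<in> X} \<union>
     {([ga] @ replicate j gb @ [gc], [ga] @ replicate j gb @ [ge]) | j. j \<in> UNIV - X}"

definition M :: "nat set \<Rightarrow> gen list set monoid" where
  "M X = presented_monoid (M_relations X)"

text \<open>The element represented by a word is the product in \<open>M X\<close> of its letters.\<close>

definition M_elem :: "nat set \<Rightarrow> gen list \<Rightarrow> gen list set" where
  "M_elem X w =
     foldr (\<lambda>g m. word_class (M_relations X) [g] \<otimes>\<^bsub>M X\<^esub> m) w \<one>\<^bsub>M X\<^esub>"

lemma M_elem_eq_word_class: "M_elem X w = word_class (M_relations X) w"
proof (induction w)
  case Nil
  show ?case
    by (simp add: M_elem_def M_def presented_monoid_def)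
next
  case (Cons g w)
  then show ?case
    using mult_word_class[of "M_relations X" "[g]" w] by (simp add: M_elem_def M_def)
qed

lemma carrier_M: "carrier (M X) = range (M_elem X)"
  by (simp add: M_def M_elem_eq_word_class[abs_def] carrier_presented_monoid)


section \<open>Oracle Turing machines\<close>

text \<open>
  Deterministic machines with a fixed number of two-way infinite read-write tapes and a
  write-only query tape. The states are the numbers below \<open>num_states\<close>, with start state 0;
  the tape symbols are the numbers below \<open>num_symbols\<close>, where 0 is the blank.
  Tape 0 initially holds the input.

  \<open>Go q acts out\<close> enters state \<open>q\<close>, writes a symbol and moves the head on each tape as told by
  \<open>acts\<close>, and appends the optional symbol \<open>out\<close> to the query tape. \<open>Query p q\<close> asks whether the
  word on the query tape belongs to the oracle, enters \<open>p\<close> (yes) or \<open>q\<close> (no), and empties the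
  query tape. Each of these takes one step, so that a query of length $n$ costs $n+1$ steps
  in total.
\<close>

datatype move = Left | Stay | Right

datatype instr =
    Halt bool
  | Query nat nat
  | Go nat "(nat \<times> move) list" "nat option"

record oracle_tm =
  num_states :: nat
  num_symbols :: nat
  num_tapes :: nat
  delta :: "nat \<Rightarrow> nat list \<Rightarrow> instr"

fun instr_ok :: "oracle_tm \<Rightarrow> instr \<Rightarrow> bool" where
  "instr_ok T (Halt b) = True"
| "instr_ok T (Query p q) = (p < num_states T \<and> q < num_states T)"
| "instr_ok T (Go q acts out) =
     (q < num_states T \<and> length acts = num_tapes T \<and>
      (\<forall>(s, m) \<in> set acts. s < num_symbols T) \<and>
      (\<forall>s \<in> set_option out. s < num_symbols T))"

definition wf_oracle_tm :: "oracle_tm \<Rightarrow> bool" where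
  "wf_oracle_tm T \<longleftrightarrow>
     0 < num_states T \<and> 0 < num_symbols T \<and> 0 < num_tapes T \<and>
     (\<forall>q < num_states T. \<forall>ss. length ss = num_tapes T \<and> (\<forall>s \<in> set ss. s < num_symbols T)
        \<longrightarrow> instr_ok T (delta T q ss))"

definition query_free :: "oracle_tm \<Rightarrow> bool" where
  "query_free T \<longleftrightarrow> (\<forall>q ss p p'. delta T q ss \<noteq> Query p p')"

text \<open>A tape is its contents together with the position of the head.\<close>

type_synonym tape = "(int \<Rightarrow> nat) \<times> int"

fun tape_read :: "tape \<Rightarrow> nat" where
  "tape_read (f, h) = f h"

fun move_offset :: "move \<Rightarrow> int" where
  "move_offset Left = - 1"
| "move_offset Stay = 0"
| "move_offset Right = 1"

fun tape_act :: "nat \<times> move \<Rightarrow> tape \<Rightarrow> tape" where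
  "tape_act (s, m) (f, h) = (f(h := s), h + move_offset m)"

definition blank_tape :: tape where
  "blank_tape = (\<lambda>_. 0, 0)"

definition input_tape :: "nat list \<Rightarrow> tape" where
  "input_tape w = (\<lambda>p. if 0 \<le> p \<and> p < int (length w) then w ! nat p else 0, 0)"

text \<open>A configuration consists of the state, the tapes and the contents of the query tape.\<close>

type_synonym config = "nat \<times> tape list \<times> nat list"

definition initial_config :: "oracle_tm \<Rightarrow> nat list \<Rightarrow> config" where
  "initial_config T w = (0, input_tape w # replicate (num_tapes T - 1) blank_tape, [])"

fun current_instr :: "oracle_tm \<Rightarrow> config \<Rightarrow> instr" where
  "current_instr T (q, ts, w) = delta T q (map tape_read ts)"

fun apply_instr :: "nat list set \<Rightarrow> instr \<Rightarrow> config \<Rightarrow> config" where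
  "apply_instr Orac (Halt b) cfg = cfg"
| "apply_instr Orac (Query p p') (q, ts, w) = (if w \<in> Orac then p else p', ts, [])"
| "apply_instr Orac (Go p acts out) (q, ts, w) =
     (p, map2 tape_act acts ts, w @ (case out of None \<Rightarrow> [] | Some s \<Rightarrow> [s]))"

definition step :: "oracle_tm \<Rightarrow> nat list set \<Rightarrow> config \<Rightarrow> config" where
  "step T Orac cfg = apply_instr Orac (current_instr T cfg) cfg"

text \<open>Halting configurations are fixed by \<open>step\<close>, so this means halting after at most \<open>t\<close> steps.\<close>

definition halts_within :: "oracle_tm \<Rightarrow> nat list set \<Rightarrow> nat list \<Rightarrow> nat \<Rightarrow> bool \<Rightarrow> bool" where
  "halts_within T Orac w t b \<longleftrightarrow>
     current_instr T ((step T Orac ^^ t) (initial_config T w)) = Halt b"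


section \<open>Decision problems\<close>

text \<open>
  A problem consists of a coding of its instances as words over the positive numbers
  (only finitely many of which occur) and the set of its yes-instances.
\<close>

datatype 'i problem = Problem (coding: "'i \<Rightarrow> nat list") (yes_instances: "'i set")

definition admits_inputs :: "oracle_tm \<Rightarrow> 'i problem \<Rightarrow> bool" where
  "admits_inputs T P \<longleftrightarrow> (\<forall>x. \<forall>s \<in> set (coding P x). 0 < s \<and> s < num_symbols T)"

definition oracle_for :: "'i problem \<Rightarrow> nat list set" where
  "oracle_for P = coding P ` yes_instances P"

definition decidable :: "'i problem \<Rightarrow> bool" where
  "decidable P \<longleftrightarrow>
     (\<exists>T. wf_oracle_tm T \<and> query_free T \<and> admits_inputs T P \<and>
       (\<forall>x. \<exists>t. halts_within T {} (coding P x) t (x \<in> yes_instances P)))"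

definition linear_time_reducible :: "'i problem \<Rightarrow> 'j problem \<Rightarrow> bool" where
  "linear_time_reducible P Q \<longleftrightarrow>
     (\<exists>T k. wf_oracle_tm T \<and> admits_inputs T P \<and>
       (\<forall>x. halts_within T (oracle_for Q) (coding P x)
              (k * length (coding P x) + k) (x \<in> yes_instances P)))"

definition linear_time_Turing_equivalent :: "'i problem \<Rightarrow> 'j problem \<Rightarrow> bool" where
  "linear_time_Turing_equivalent P Q \<longleftrightarrow>
     linear_time_reducible P Q \<and> linear_time_reducible Q P"

fun gen_code :: "gen \<Rightarrow> nat" where
  "gen_code ga = 1"
| "gen_code gb = 2"
| "gen_code gc = 3"
| "gen_code gd = 4"
| "gen_code ge = 5"

text \<open>The two words of an instance are separated by the symbol 6.\<close>

definition word_problem :: "nat set \<Rightarrow> (gen list \<times> gen list) problem" where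
  "word_problem X =
     Problem (\<lambda>(u, v). map gen_code u @ [6] @ map gen_code v)
             {(u, v). M_elem X u = M_elem X v}"

definition unary_membership_problem :: "nat set \<Rightarrow> nat problem" where
  "unary_membership_problem X = Problem (\<lambda>n. replicate n 1) X"

text \<open>Recursive sets in the sense of Turing, with numbers given to the machine in unary.\<close>

definition recursive_set :: "nat set \<Rightarrow> bool" where
  "recursive_set X \<longleftrightarrow> decidable (unary_membership_problem X)"

end

theory Submission
  imports Defs "HOL-Library.Nat_Bijection"
begin

text \<open>
  Applying the relations towards the letter $c$ gives normal forms: a letter $c$, $d$ or $e$ is
  only ever rewritten when it is preceded by some $ab^i$, and rewriting it creates no further
  factor $ab^j$. So two words are equal in $M(X)$ iff they have the same length and differ at most
  in letters preceded by the same $ab^i$, where $c \leftrightarrow d$ is allowed iff $i \in X$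
  and $c \leftrightarrow e$ is allowed iff $i \notin X$; this takes one comparison scan, whose
  queries have total length at most that of the input. Conversely, $n \in X$ iff
  $ab^nc = ab^nd$. Decidability transfers because an oracle machine whose queries are instances
  of a decidable problem can be run without the oracle.
\<close>

section \<open>Equality in $M(X)$\<close>

text \<open>One pass suffices because \<open>scan\<close> treats \<open>gc\<close>,
  \<open>gd\<close> and \<open>ge\<close> alike: rewriting never changes a later state, so states
  may be computed on the original word. Linear time rests on two points. The two words lie on one
  tape, and shuttling between them letter by letter would cost quadratic time, so the first is
  copied to a second tape. The exponent i, which finite control cannot hold, is built up in unary on
  the query tape while the letters b are being read, so writing a query costs nothing beyond the
  scan. Decidability is not a formal consequence of the two reductions, since
  \<open>linear_time_reducible\<close> also lets a machine query words that code no instance. Each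
  machine is therefore analysed once through \<open>yields\<close>, with the range of the coding as
  \<open>V\<close>; this one fact gives the time bound and also feeds the removal of the
  oracle.\<close>

text \<open>The state \<open>Some i\<close> records that the word read so far ends in $ab^i$.\<close>

fun scan :: "nat option \<Rightarrow> gen \<Rightarrow> nat option" where
  "scan s ga = Some 0"
| "scan (Some i) gb = Some (Suc i)"
| "scan s x = None"

definition canon :: "nat set \<Rightarrow> nat option \<Rightarrow> gen \<Rightarrow> gen" where
  "canon X s x = (case s of None \<Rightarrow> x | Some i \<Rightarrow> if x = (if i \<in> X then gd else ge) then gc else x)"

primrec normal_form :: "nat set \<Rightarrow> nat option \<Rightarrow> gen list \<Rightarrow> gen list" where
  "normal_form X s [] = []"
| "normal_form X s (x # u) = canon X s x # normal_form X (scan s x) u"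

primrec scanned_suffix :: "nat option \<Rightarrow> gen list" where
  "scanned_suffix None = []"
| "scanned_suffix (Some i) = ga # replicate i gb"

lemma normal_form_append:
  "normal_form X s (u @ v) = normal_form X s u @ normal_form X (foldl scan s u) v"
  by (induction u arbitrary: s) auto

lemma foldl_scan_replicate: "foldl scan (Some j) (replicate i gb) = Some (j + i)"
  by (induction i arbitrary: j) auto

lemma normal_form_replicate: "normal_form X (Some j) (replicate i gb) = replicate i gb"
  by (induction i arbitrary: j) (auto simp: canon_def)

lemma normal_form_relation:
  "normal_form X s (ga # replicate i gb @ [x]) = ga # replicate i gb @ [canon X (Some i) x]"
  by (cases s)
    (auto simp: normal_form_append normal_form_replicate foldl_scan_replicate canon_def)

text \<open>The second conjunct and the arbitrary start state serve the product rule: in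
  \<open>u @ u'\<close> the factor \<open>u'\<close> is normalised from the state that
  \<open>u\<close> leaves, which must be the one that \<open>v\<close> leaves. For a relation the
  start state is lost at its first letter \<open>ga\<close>, and both sides end in state
  \<open>None\<close>.\<close>

lemma pres_eq_imp_normal_form_eq:
  assumes "pres_eq (M_relations X) u v"
  shows "normal_form X s u = normal_form X s v \<and> foldl scan s u = foldl scan s v"
  using assms
proof (induction arbitrary: s)
  case (rel u v)
  then show ?case
    by (auto simp: M_relations_def normal_form_relation canon_def foldl_scan_replicate
        simp del: normal_form.simps)
next
  case (mult u v u' v')
  then show ?case
    by (simp add: normal_form_append)
qed auto

lemma pres_eq_canon:
  "pres_eq (M_relations X) (scanned_suffix s @ [x]) (scanned_suffix s @ [canon X s x])"
proof (cases "canon X s x = x")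
  case True
  then show ?thesis
    by (simp add: pres_eq.refl)
next
  case False
  then obtain i where s: "s = Some i" and x: "x = (if i \<in> X then gd else ge)"
    and c: "canon X s x = gc"
    by (auto simp: canon_def split: option.splits if_splits)
  have "([ga] @ replicate i gb @ [gc], [ga] @ replicate i gb @ [x]) \<in> M_relations X"
    using x by (auto simp: M_relations_def)
  then show ?thesis
    unfolding s c[unfolded s] by (auto intro: pres_eq.intros)
qed

text \<open>Normalising from \<open>Some i\<close> is only justified behind $ab^i$, hence the prefix
  \<open>scanned_suffix s\<close>.\<close>

lemma pres_eq_normal_form:
  "pres_eq (M_relations X) (scanned_suffix s @ u) (scanned_suffix s @ normal_form X s u)"
proof (induction u arbitrary: s)
  case Nil
  show ?case
    by (simp add: pres_eq.refl)
next
  case (Cons x u)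
  show ?case
  proof (cases "scan s x")
    case None
    then show ?thesis
      using pres_eq.mult[OF pres_eq_canon Cons.IH[of None], of s x] by simp
  next
    case (Some i)
    \<comment> \<open>A letter leading to \<open>Some i\<close> is \<open>ga\<close> or
      \<open>gb\<close>, which \<open>canon\<close> leaves alone. The prefix extended by it ends in
      the new scanned suffix, and \<open>p\<close> is what stands before: the old suffix for
      \<open>ga\<close>, nothing for \<open>gb\<close>.\<close>
    then obtain p where p: "scanned_suffix s @ [x] = p @ scanned_suffix (scan s x)"
      and "canon X s x = x"
    proof (cases x)
      case ga
      then show thesis
        using that[of "scanned_suffix s"] by (cases s) (auto simp: canon_def)
    next
      case gb
      then show thesis
        using Some that[of "[]"] by (cases s) (auto simp: canon_def replicate_append_same)
    qed (use Some in \<open>cases s; simp\<close>)+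
    have "scanned_suffix s @ x # w = p @ scanned_suffix (scan s x) @ w" for w
      using arg_cong[OF p, of "\<lambda>z. z @ w"] by simp
    then show ?thesis
      using pres_eq.mult[OF pres_eq.refl[of _ p] Cons.IH[of "scan s x"]] \<open>canon X s x = x\<close>
      by (simp only: normal_form.simps)
  qed
qed

lemma M_elem_eq_iff: "M_elem X u = M_elem X v \<longleftrightarrow> normal_form X None u = normal_form X None v"
proof -
  have "pres_eq (M_relations X) u (normal_form X None u)" for u
    using pres_eq_normal_form[of X None u] by simp
  then show ?thesis
    unfolding M_elem_eq_word_class word_class_eq_iff
    by (metis pres_eq.sym pres_eq.trans pres_eq_imp_normal_form_eq)
qed


section \<open>Halting computations\<close>

text \<open>All queries are required to lie in \<open>V\<close> because a decider that is to replace the oracle need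
  not halt on words outside the range of the coding.\<close>

inductive yields ::
  "oracle_tm \<Rightarrow> nat list set \<Rightarrow> nat list set \<Rightarrow> config \<Rightarrow> nat \<Rightarrow> bool \<Rightarrow> bool"
  for T Orac V where
  halt: "current_instr T c = Halt b \<Longrightarrow> yields T Orac V c t b"
| step: "(\<And>p p'. current_instr T c = Query p p' \<Longrightarrow> snd (snd c) \<in> V) \<Longrightarrow>
    yields T Orac V (step T Orac c) t b \<Longrightarrow> yields T Orac V c (Suc t) b"

lemma yields_mono: "yields T Orac V c t b \<Longrightarrow> t \<le> t' \<Longrightarrow> yields T Orac V c t' b"
proof (induction arbitrary: t' rule: yields.induct)
  case (step c t b)
  then show ?case
    by (cases t') (auto intro: yields.step)
qed (rule yields.halt)

lemma step_Halt: "current_instr T c = Halt b \<Longrightarrow> step T Orac c = c"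
  by (simp add: step_def)

lemma halting_if_yields:
  "yields T Orac V c t b \<Longrightarrow> current_instr T ((step T Orac ^^ t) c) = Halt b"
proof (induction rule: yields.induct)
  case (halt c b t)
  then have "(step T Orac ^^ t) c = c"
    by (induction t) (auto simp: step_Halt)
  with halt show ?case
    by simp
qed (simp add: funpow_swap1)

lemma yields_if_halting:
  "current_instr T ((step T Orac ^^ t) c) = Halt b \<Longrightarrow> yields T Orac UNIV c t b"
proof (induction t arbitrary: c)
  case (Suc t)
  then show ?case
    by (intro yields.step) (simp_all add: funpow_swap1)
qed (simp add: yields.halt)

lemma halts_within_if_yields:
  "yields T Orac V (initial_config T w) t b \<Longrightarrow> halts_within T Orac w t b"
  by (simp add: halts_within_def halting_if_yields)

lemma yields_Halt: "delta T q (map tape_read ts) = Halt b \<Longrightarrow> yields T Orac V (q, ts, w) t b"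
  by (simp add: yields.halt)

lemma yields_Go:
  "\<lbrakk>delta T q (map tape_read ts) = Go p acts out;
    yields T Orac V (p, map2 tape_act acts ts, w @ (case out of None \<Rightarrow> [] | Some s \<Rightarrow> [s])) t b\<rbrakk>
   \<Longrightarrow> yields T Orac V (q, ts, w) (Suc t) b"
  by (rule yields.step) (simp_all add: step_def)

lemma yields_Query:
  "\<lbrakk>delta T q (map tape_read ts) = Query p p'; w \<in> V;
    yields T Orac V (if w \<in> Orac then p else p', ts, []) t b\<rbrakk>
   \<Longrightarrow> yields T Orac V (q, ts, w) (Suc t) b"
  by (rule yields.step) (simp_all add: step_def)

lemma wf_oracle_tmD:
  "\<lbrakk>wf_oracle_tm T; q < num_states T; length ss = num_tapes T; \<forall>s\<in>set ss. s < num_symbols T\<rbrakk>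
   \<Longrightarrow> instr_ok T (delta T q ss)"
  by (simp add: wf_oracle_tm_def)


section \<open>Eliminating the oracle\<close>

text \<open>
  A query-free machine \<open>T\<close> answering the queries of \<open>S\<close> runs on additional tapes, the first of
  which doubles as the query tape of \<open>S\<close>. Since \<open>T\<close> leaves these tapes dirty, they are erased
  after every query. To find the cells that have to be erased, \<open>T\<close> is made to write the new
  symbol \<open>num_symbols T\<close> in place of the blank, so that the visited cells form an interval of
  non-blank cells.
\<close>

datatype phase = Outer nat | Rewind nat nat | Inner nat nat nat | Forward nat | Erase nat

text \<open>Machine states are numbers. The tag 0 for \<open>Outer\<close> gives
  \<open>Outer 0\<close> the code 0, that of the start state.\<close>

fun phase_code :: "phase \<Rightarrow> nat" where
  "phase_code (Outer q) = prod_encode (0, q)"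
| "phase_code (Rewind p p') = prod_encode (1, prod_encode (p, p'))"
| "phase_code (Inner p p' q) = prod_encode (2, prod_encode (p, prod_encode (p', q)))"
| "phase_code (Forward p) = prod_encode (3, p)"
| "phase_code (Erase p) = prod_encode (4, p)"

lemma inj_phase_code: "inj phase_code"
proof (rule injI)
  fix x y
  show "phase_code x = phase_code y \<Longrightarrow> x = y"
    by (cases x; cases y) simp_all
qed

declare phase_code.simps [simp del]

definition stay :: "nat list \<Rightarrow> (nat \<times> move) list" where
  "stay ss = map (\<lambda>s. (s, Stay)) ss"

lemma length_stay [simp]: "length (stay ss) = length ss"
  by (simp add: stay_def)

lemma set_stay [simp]: "set (stay ss) = (\<lambda>s. (s, Stay)) ` set ss"
  by (simp add: stay_def)

lemma map2_stay [simp]: "map2 tape_act (stay (map tape_read ts)) ts = ts"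
  by (induction ts) (auto simp: stay_def)

section \<open>The combined machine and its well-formedness\<close>

locale oracle_elimination =
  fixes S T :: oracle_tm
  assumes wf_S: "wf_oracle_tm S" and wf_T: "wf_oracle_tm T" and query_free_T: "query_free T"
begin

definition mark :: "nat \<Rightarrow> nat" where
  "mark s = (if s = 0 then num_symbols T else s)"

text \<open>A cell never visited (0) and a cell on which T wrote its blank
  (\<open>num_symbols T\<close>) both look blank to T.\<close>

definition unmark :: "nat \<Rightarrow> nat" where
  "unmark s = (if s = num_symbols T then 0 else s)"

text \<open>\<open>Outer\<close> runs S, \<open>Rewind\<close> takes the query head back to the
  start of the query, \<open>Inner\<close> runs T on it, \<open>Forward\<close> sends every
  additional head to the first blank on its right, and \<open>Erase\<close> wipes leftwards from
  there; the states in which S may resume are carried along. When T halts, every head cell is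
  overwritten by a nonblank symbol. In the last two phases a head that has arrived waits for the
  others.\<close>

fun phase_instr :: "phase \<Rightarrow> nat list \<Rightarrow> nat list \<Rightarrow> instr" where
  "phase_instr (Outer q) ss rs =
    (case delta S q ss of
       Halt b \<Rightarrow> Halt b
     | Query p p' \<Rightarrow> Go (phase_code (Rewind p p')) (stay ss @ (0, Left) # stay (tl rs)) None
     | Go q' acts out \<Rightarrow>
         Go (phase_code (Outer q'))
           (acts @ (case out of None \<Rightarrow> (0, Stay) | Some s \<Rightarrow> (s, Right)) # stay (tl rs)) None)"
| "phase_instr (Rewind p p') ss rs =
    (if hd rs = 0 then Go (phase_code (Inner p p' 0)) (stay ss @ (0, Right) # stay (tl rs)) None
     else Go (phase_code (Rewind p p')) (stay ss @ (hd rs, Left) # stay (tl rs)) None)"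
| "phase_instr (Inner p p' q) ss rs =
    (case delta T q (map unmark rs) of
       Halt b \<Rightarrow>
         Go (phase_code (Forward (if b then p else p')))
           (stay ss @ map (\<lambda>_. (num_symbols T, Stay)) rs) None
     | Query _ _ \<Rightarrow> Halt False
     | Go q' acts out \<Rightarrow>
         Go (phase_code (Inner p p' q')) (stay ss @ map (\<lambda>(s, m). (mark s, m)) acts) None)"
| "phase_instr (Forward p) ss rs =
    (if set rs \<subseteq> {0} then Go (phase_code (Erase p)) (stay ss @ map (\<lambda>_. (0, Left)) rs) None
     else Go (phase_code (Forward p))
       (stay ss @ map (\<lambda>s. (s, if s = 0 then Stay else Right)) rs) None)"
| "phase_instr (Erase p) ss rs =
    (if set rs \<subseteq> {0} then Go (phase_code (Outer p)) (stay ss @ stay rs) None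
     else Go (phase_code (Erase p))
       (stay ss @ map (\<lambda>s. (0, if s = 0 then Stay else Left)) rs) None)"

definition phases :: "phase set" where
  "phases =
    Outer ` {..<num_states S} \<union>
    (\<lambda>(p, p'). Rewind p p') ` ({..<num_states S} \<times> {..<num_states S}) \<union>
    (\<lambda>(p, p', q). Inner p p' q) `
      ({..<num_states S} \<times> {..<num_states S} \<times> {..<num_states T}) \<union>
    Forward ` {..<num_states S} \<union> Erase ` {..<num_states S}"

lemma in_phases [simp]:
  "Outer q \<in> phases \<longleftrightarrow> q < num_states S"
  "Rewind p p' \<in> phases \<longleftrightarrow> p < num_states S \<and> p' < num_states S"
  "Inner p p' r \<in> phases \<longleftrightarrow> p < num_states S \<and> p' < num_states S \<and> r < num_states T"
  "Forward p \<in> phases \<longleftrightarrow> p < num_states S"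
  "Erase p \<in> phases \<longleftrightarrow> p < num_states S"
  by (auto simp: phases_def image_iff)

lemma finite_phases: "finite phases"
  by (simp add: phases_def)

definition valid :: "phase \<Rightarrow> nat list \<Rightarrow> nat list \<Rightarrow> bool" where
  "valid x ss rs \<longleftrightarrow>
    x \<in> phases \<and> length ss = num_tapes S \<and> length rs = num_tapes T \<and>
    (\<forall>s\<in>set ss. s < num_symbols S) \<and> (\<forall>s\<in>set rs. s \<le> num_symbols T)"

text \<open>Not every number below \<open>num_states\<close> codes a phase, and the joint alphabet
  admits symbols foreign to S or T. Such situations lead to \<open>Halt False\<close>, so
  well-formedness needs no invariant about runs.\<close>

definition combined :: oracle_tm where
  "combined =
    \<lparr> num_states = Suc (Max (phase_code ` phases)),
      num_symbols = max (num_symbols S) (Suc (num_symbols T)),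
      num_tapes = num_tapes S + num_tapes T,
      delta = (\<lambda>q ss.
        let x = inv_into UNIV phase_code q; rs = drop (num_tapes S) ss; ss = take (num_tapes S) ss in
        if q \<in> range phase_code \<and> valid x ss rs then phase_instr x ss rs else Halt False) \<rparr>"

lemma combined_simps [simp]:
  "num_symbols combined = max (num_symbols S) (Suc (num_symbols T))"
  "num_tapes combined = num_tapes S + num_tapes T"
  by (simp_all add: combined_def)

lemma phase_code_less [simp]: "x \<in> phases \<Longrightarrow> phase_code x < num_states combined"
  using finite_phases by (simp add: combined_def less_Suc_eq_le)

lemma S_pos: "0 < num_states S" "0 < num_symbols S" "0 < num_tapes S"
  and T_pos: "0 < num_states T" "0 < num_symbols T" "0 < num_tapes T"
  using wf_S wf_T by (simp_all add: wf_oracle_tm_def)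

lemma unmark_less: "s \<le> num_symbols T \<Longrightarrow> unmark s < num_symbols T"
  using T_pos by (auto simp: unmark_def)

lemma mark_le: "s < num_symbols T \<Longrightarrow> mark s \<le> num_symbols T"
  by (auto simp: mark_def)

lemma instr_ok_phase_instr:
  assumes "valid x ss rs"
  shows "instr_ok combined (phase_instr x ss rs)"
proof -
  have len: "length ss = num_tapes S" "length rs = num_tapes T" "Suc (length (tl rs)) = num_tapes T"
    and ss: "\<forall>s\<in>set ss. s < num_symbols S" and rs: "\<forall>s\<in>set rs. s \<le> num_symbols T"
    and tl: "\<forall>s\<in>set (tl rs). s \<le> num_symbols T" and hd: "hd rs \<le> num_symbols T"
    using assms T_pos by (cases rs; auto simp: valid_def)+
  show ?thesis
  proof (cases x)
    case (Outer q)
    then have "instr_ok S (delta S q ss)"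
      using assms wf_S by (auto simp: valid_def intro: wf_oracle_tmD)
    then show ?thesis
      using Outer len ss tl
      by (cases "delta S q ss") (auto simp: less_max_iff_disj less_Suc_eq_le valid_def split: option.splits)
  next
    case (Rewind p p')
    then show ?thesis
      using len ss tl hd assms T_pos by (auto simp: valid_def less_max_iff_disj less_Suc_eq_le)
  next
    case (Inner p p' q)
    then have "instr_ok T (delta T q (map unmark rs))"
      using assms wf_T by (auto simp: valid_def unmark_less intro!: wf_oracle_tmD)
    then show ?thesis
      using Inner len ss assms
      by (cases "delta T q (map unmark rs)")
        (auto simp: valid_def less_max_iff_disj less_Suc_eq_le intro: mark_le)
  next
    case (Forward p)
    then show ?thesis
      using len ss rs assms by (auto simp: valid_def less_max_iff_disj less_Suc_eq_le)
  next
    case (Erase p)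
    then show ?thesis
      using len ss rs assms by (auto simp: valid_def less_max_iff_disj less_Suc_eq_le)
  qed
qed

lemma wf_combined: "wf_oracle_tm combined"
  unfolding wf_oracle_tm_def
proof (intro conjI allI impI)
  fix q ss
  assume "q < num_states combined"
  show "instr_ok combined (delta combined q ss)"
    using instr_ok_phase_instr by (simp add: combined_def Let_def)
qed (use S_pos in \<open>simp_all add: combined_def\<close>)

lemma query_free_combined: "query_free combined"
  unfolding query_free_def
proof (intro allI)
  fix q ss p p'
  have "phase_instr x ss rs \<noteq> Query p p'" for x ss rs
    by (cases x) (auto split: instr.splits)
  then show "delta combined q ss \<noteq> Query p p'"
    by (simp add: combined_def Let_def)
qed

text \<open>Running times are hidden, as decidability asks only for halting. The lemmas on phases
  argue backwards: if the configurations that may follow the phase answer \<open>b\<close>, so does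
  the one before it.\<close>

definition answers :: "config \<Rightarrow> bool \<Rightarrow> bool" where
  "answers c b \<longleftrightarrow> (\<exists>t. yields combined {} UNIV c t b)"

lemma delta_combined:
  assumes "valid x (map tape_read ts) (map tape_read us)"
  shows "delta combined (phase_code x) (map tape_read (ts @ us)) =
    phase_instr x (map tape_read ts) (map tape_read us)"
proof -
  have "length ts = num_tapes S"
    using assms by (simp add: valid_def)
  then show ?thesis
    using assms inj_phase_code by (simp add: combined_def Let_def inv_f_f)
qed

lemma answers_Go:
  assumes "valid x (map tape_read ts) (map tape_read us)"
    and "phase_instr x (map tape_read ts) (map tape_read us) = Go (phase_code y) (as @ bs) None"
    and "length as = length ts"
    and "answers (phase_code y, map2 tape_act as ts @ map2 tape_act bs us, []) b"
  shows "answers (phase_code x, ts @ us, []) b"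
proof -
  obtain t where "yields combined {} UNIV
      (phase_code y, map2 tape_act as ts @ map2 tape_act bs us, []) t b"
    using assms(4) by (auto simp: answers_def)
  then have "yields combined {} UNIV
      (phase_code y, map2 tape_act (as @ bs) (ts @ us),
        [] @ (case None of None \<Rightarrow> [] | Some s \<Rightarrow> [s])) t b"
    using assms(3) by simp
  then have "yields combined {} UNIV (phase_code x, ts @ us, []) (Suc t) b"
    using delta_combined[OF assms(1), unfolded assms(2)] by (intro yields_Go)
  then show ?thesis
    by (auto simp: answers_def)
qed

section \<open>Erasing the additional tapes\<close>

definition S_tapes :: "tape list \<Rightarrow> bool" where
  "S_tapes ts \<longleftrightarrow> length ts = num_tapes S \<and> (\<forall>t\<in>set ts. \<forall>p. fst t p < num_symbols S)"

lemma tape_read_eq: "tape_read u = fst u (snd u)"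
  by (cases u) simp

lemma fst_tape_act: "fst (tape_act a u) = (fst u)(snd u := fst a)"
  by (cases a; cases u) simp

lemma snd_tape_act: "snd (tape_act a u) = snd u + move_offset (snd a)"
  by (cases a; cases u) simp

lemma S_tapes_act:
  assumes "S_tapes ts" "length acts = num_tapes S" "\<forall>(s, m)\<in>set acts. s < num_symbols S"
  shows "S_tapes (map2 tape_act acts ts)"
proof -
  have "fst t p < num_symbols S" if *: "t \<in> set (map2 tape_act acts ts)" for t p
  proof -
    obtain s m f h where "((s, m), (f, h)) \<in> set (zip acts ts)" and t: "t = tape_act (s, m) (f, h)"
      using * by auto
    then have "(s, m) \<in> set acts" "(f, h) \<in> set ts"
      by (auto dest: set_zip_leftD set_zip_rightD)
    then show ?thesis
      using assms by (fastforce simp: S_tapes_def t)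
  qed
  then show ?thesis
    using assms by (simp add: S_tapes_def)
qed

lemma validI:
  assumes "x \<in> phases" "S_tapes ts" "length us = num_tapes T"
    and "\<forall>u\<in>set us. tape_read u \<le> num_symbols T"
  shows "valid x (map tape_read ts) (map tape_read us)"
  using assms by (auto simp: valid_def S_tapes_def tape_read_eq)

lemma map2_map_reads:
  "map2 tape_act (map f (map tape_read us)) us = map (\<lambda>u. tape_act (f (tape_read u)) u) us"
  by (induction us) auto

text \<open>On each tape the nonblank cells are \<open>m\<close> cells ending at the head, and each
  round removes the last one. The induction is on a common bound \<open>n\<close> because the phase
  ends only when all heads read a blank.\<close>

lemma answers_Erase:
  assumes "p < num_states S" "S_tapes ts" "length us = num_tapes T"
    and "\<forall>u\<in>set us. (\<forall>x. fst u x \<le> num_symbols T) \<and>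
      (\<exists>m\<le>n. \<forall>x. fst u x \<noteq> 0 \<longleftrightarrow> snd u - int m < x \<and> x \<le> snd u)"
    and "\<And>us'. length us' = num_tapes T \<Longrightarrow> \<forall>u\<in>set us'. \<forall>x. fst u x = 0 \<Longrightarrow>
      answers (phase_code (Outer p), ts @ us', []) b"
  shows "answers (phase_code (Erase p), ts @ us, []) b"
proof -
  have val: "valid (Erase p) (map tape_read ts) (map tape_read us)"
    if "length us = num_tapes T" "\<forall>u\<in>set us. (\<forall>x. fst u x \<le> num_symbols T) \<and> P u" for us P
    using that assms(1,2) by (intro validI) (auto simp: tape_read_eq)
  have erased: "answers (phase_code (Erase p), ts @ us, []) b"
    if len: "length us = num_tapes T" and us: "\<forall>u\<in>set us. (\<forall>x. fst u x \<le> num_symbols T) \<and>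
      (\<exists>m\<le>n. \<forall>x. fst u x \<noteq> 0 \<longleftrightarrow> snd u - int m < x \<and> x \<le> snd u)"
      and zero: "\<forall>u\<in>set us. tape_read u = 0" for us n
  proof (rule answers_Go)
    show "valid (Erase p) (map tape_read ts) (map tape_read us)"
      using len us by (rule val)
    show "phase_instr (Erase p) (map tape_read ts) (map tape_read us) =
        Go (phase_code (Outer p)) (stay (map tape_read ts) @ stay (map tape_read us)) None"
      using zero by auto
    have "fst u x = 0" if u: "u \<in> set us" for u x
    proof -
      obtain m where m: "\<And>x. fst u x \<noteq> 0 \<longleftrightarrow> snd u - int m < x \<and> x \<le> snd u"
        using us u by blast
      have "fst u (snd u) = 0"
        using u zero by (simp add: tape_read_eq)
      then have "m = 0"
        using m[of "snd u"] by simp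
      then show ?thesis
        using m[of x] by auto
    qed
    then show "answers (phase_code (Outer p), map2 tape_act (stay (map tape_read ts)) ts @
        map2 tape_act (stay (map tape_read us)) us, []) b"
      using assms(5)[of us] len by simp
  qed simp
  show ?thesis
    using assms(3,4)
  proof (induction n arbitrary: us)
    case 0
    then have "\<forall>u\<in>set us. tape_read u = 0"
      by (fastforce simp: tape_read_eq)
    with 0 show ?case
      by (intro erased)
  next
    case (Suc n)
    show ?case
    proof (cases "\<forall>u\<in>set us. tape_read u = 0")
      case True
      with Suc.prems show ?thesis
        by (intro erased)
    next
      case False
      let ?f = "\<lambda>s. (0, if s = 0 then Stay else Left)"
      let ?us = "map (\<lambda>u. tape_act (?f (tape_read u)) u) us"
      show ?thesis
      proof (rule answers_Go)
        show "valid (Erase p) (map tape_read ts) (map tape_read us)"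
          using Suc.prems by (rule val)
        show "phase_instr (Erase p) (map tape_read ts) (map tape_read us) =
            Go (phase_code (Erase p)) (stay (map tape_read ts) @ map ?f (map tape_read us)) None"
          using False by auto
        have "(\<forall>x. fst u' x \<le> num_symbols T) \<and>
            (\<exists>m\<le>n. \<forall>x. fst u' x \<noteq> 0 \<longleftrightarrow> snd u' - int m < x \<and> x \<le> snd u')" if u': "u' \<in> set ?us" for u'
        proof -
          obtain u where u: "u \<in> set us" "u' = tape_act (?f (tape_read u)) u"
            using u' by auto
          obtain m where m: "m \<le> Suc n" "\<And>x. fst u x \<noteq> 0 \<longleftrightarrow> snd u - int m < x \<and> x \<le> snd u"
            using Suc.prems u(1) by blast
          have m0: "m = 0 \<longleftrightarrow> fst u (snd u) = 0"
            using m(2)[of "snd u"] by auto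
          \<comment> \<open>Truncated subtraction covers tapes that are already blank: there
            \<open>m\<close> is 0 and the head stays.\<close>
          have "fst u' x \<noteq> 0 \<longleftrightarrow> snd u' - int (m - 1) < x \<and> x \<le> snd u'" for x
            using m(2)[of x] m0
            by (auto simp: u(2) fst_tape_act snd_tape_act tape_read_eq of_nat_diff)
          then show ?thesis
            using Suc.prems u m(1) by (auto simp: fst_tape_act intro!: exI[of _ "m - 1"])
        qed
        then show "answers (phase_code (Erase p), map2 tape_act (stay (map tape_read ts)) ts @
            map2 tape_act (map ?f (map tape_read us)) us, []) b"
          unfolding map2_map_reads map2_stay using Suc.prems by (intro Suc.IH) auto
      qed simp
    qed
  qed
qed

text \<open>Here \<open>m\<close> counts the nonblank cells from the head rightwards and so bounds
  the moves still to be made; the left end \<open>l\<close> only decides how much remains for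
  \<open>Erase\<close>.\<close>

lemma answers_Forward:
  assumes "p < num_states S" "S_tapes ts" "length us = num_tapes T"
    and "\<forall>u\<in>set us. (\<forall>x. fst u x \<le> num_symbols T) \<and>
      (\<exists>l\<le>snd u. \<exists>m\<le>n. \<forall>x. fst u x \<noteq> 0 \<longleftrightarrow> l \<le> x \<and> x < snd u + int m)"
    and "\<And>us'. length us' = num_tapes T \<Longrightarrow> \<forall>u\<in>set us'. \<forall>x. fst u x = 0 \<Longrightarrow>
      answers (phase_code (Outer p), ts @ us', []) b"
  shows "answers (phase_code (Forward p), ts @ us, []) b"
proof -
  have val: "valid (Forward p) (map tape_read ts) (map tape_read us)"
    if "length us = num_tapes T" "\<forall>u\<in>set us. (\<forall>x. fst u x \<le> num_symbols T) \<and> P u" for us P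
    using that assms(1,2) by (intro validI) (auto simp: tape_read_eq)
  have erase: "answers (phase_code (Forward p), ts @ us, []) b"
    if len: "length us = num_tapes T" and us: "\<forall>u\<in>set us. (\<forall>x. fst u x \<le> num_symbols T) \<and>
      (\<exists>l\<le>snd u. \<exists>m\<le>n. \<forall>x. fst u x \<noteq> 0 \<longleftrightarrow> l \<le> x \<and> x < snd u + int m)"
      and zero: "\<forall>u\<in>set us. tape_read u = 0" for us n
  proof (rule answers_Go)
    show "valid (Forward p) (map tape_read ts) (map tape_read us)"
      using len us by (rule val)
    show "phase_instr (Forward p) (map tape_read ts) (map tape_read us) =
        Go (phase_code (Erase p))
          (stay (map tape_read ts) @ map (\<lambda>_. (0, Left)) (map tape_read us)) None"
      using zero by auto
    let ?us = "map (\<lambda>u. tape_act (0, Left) u) us"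
    have interval: "\<exists>m. \<forall>x. fst u' x \<noteq> 0 \<longleftrightarrow> snd u' - int m < x \<and> x \<le> snd u'" if u': "u' \<in> set ?us" for u'
    proof -
      obtain u where u: "u \<in> set us" "u' = tape_act (0, Left) u"
        using u' by auto
      obtain l m where l: "l \<le> snd u" and m: "\<And>x. fst u x \<noteq> 0 \<longleftrightarrow> l \<le> x \<and> x < snd u + int m"
        using us u(1) by blast
      have z: "fst u (snd u) = 0"
        using u zero by (simp add: tape_read_eq)
      then have "m = 0"
        using m[of "snd u"] l by simp
      \<comment> \<open>As \<open>m = 0\<close>, the interval ends just before the old head
        position, so the move left puts the head on its last cell, with \<open>snd u - l\<close>
        cells to erase.\<close>
      have "fst u' x \<noteq> 0 \<longleftrightarrow> snd u' - int (nat (snd u - l)) < x \<and> x \<le> snd u'" for x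
        using m[of x] l z \<open>m = 0\<close> by (auto simp: u(2) fst_tape_act snd_tape_act)
      then show ?thesis
        by blast
    qed
    then obtain k where k: "\<And>u'. u' \<in> set ?us \<Longrightarrow>
        \<forall>x. fst u' x \<noteq> 0 \<longleftrightarrow> snd u' - int (k u') < x \<and> x \<le> snd u'"
      by metis
    \<comment> \<open>The maximum turns the lengths of the individual tapes into the common bound
      that \<open>answers_Erase\<close> requires.\<close>
    have "\<exists>m\<le>Max (k ` set ?us). \<forall>x. fst u' x \<noteq> 0 \<longleftrightarrow> snd u' - int m < x \<and> x \<le> snd u'"
      if "u' \<in> set ?us" for u'
      using k[OF that] that by (intro exI[of _ "k u'"] conjI Max_ge) auto
    moreover have "\<forall>x. fst u' x \<le> num_symbols T" if "u' \<in> set ?us" for u'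
      using us that by (auto simp: fst_tape_act)
    ultimately have "\<forall>u\<in>set ?us. (\<forall>x. fst u x \<le> num_symbols T) \<and>
        (\<exists>m\<le>Max (k ` set ?us). \<forall>x. fst u x \<noteq> 0 \<longleftrightarrow> snd u - int m < x \<and> x \<le> snd u)"
      by blast
    moreover have "length ?us = num_tapes T"
      using len by simp
    ultimately have "answers (phase_code (Erase p), ts @ ?us, []) b"
      using answers_Erase[OF assms(1,2)] assms(5) by blast
    then show "answers (phase_code (Erase p), map2 tape_act (stay (map tape_read ts)) ts @
        map2 tape_act (map (\<lambda>_. (0, Left)) (map tape_read us)) us, []) b"
      unfolding map2_map_reads map2_stay .
  qed simp
  show ?thesis
    using assms(3,4)
  proof (induction n arbitrary: us)
    case 0
    then have "\<forall>u\<in>set us. tape_read u = 0"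
      by (fastforce simp: tape_read_eq)
    with 0 show ?case
      by (intro erase)
  next
    case (Suc n)
    show ?case
    proof (cases "\<forall>u\<in>set us. tape_read u = 0")
      case True
      with Suc.prems show ?thesis
        by (intro erase)
    next
      case False
      let ?f = "\<lambda>s. (s, if s = 0 then Stay else Right)"
      let ?us = "map (\<lambda>u. tape_act (?f (tape_read u)) u) us"
      show ?thesis
      proof (rule answers_Go)
        show "valid (Forward p) (map tape_read ts) (map tape_read us)"
          using Suc.prems by (rule val)
        show "phase_instr (Forward p) (map tape_read ts) (map tape_read us) =
            Go (phase_code (Forward p)) (stay (map tape_read ts) @ map ?f (map tape_read us)) None"
          using False by auto
        have "(\<forall>x. fst u' x \<le> num_symbols T) \<and>
            (\<exists>l\<le>snd u'. \<exists>m\<le>n. \<forall>x. fst u' x \<noteq> 0 \<longleftrightarrow> l \<le> x \<and> x < snd u' + int m)" if u': "u' \<in> set ?us" for u'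
        proof -
          obtain u where u: "u \<in> set us" "u' = tape_act (?f (tape_read u)) u"
            using u' by auto
          obtain l m where l: "l \<le> snd u" and m: "m \<le> Suc n"
            "\<And>x. fst u x \<noteq> 0 \<longleftrightarrow> l \<le> x \<and> x < snd u + int m"
            using Suc.prems u(1) by blast
          have m0: "m = 0 \<longleftrightarrow> fst u (snd u) = 0"
            using m(2)[of "snd u"] l by auto
          have "fst u' = fst u" "l \<le> snd u'"
            using l by (auto simp: u(2) fst_tape_act snd_tape_act tape_read_eq)
          moreover have "fst u' x \<noteq> 0 \<longleftrightarrow> l \<le> x \<and> x < snd u' + int (m - 1)" for x
            using m(2)[of x] m0 l
            by (auto simp: u(2) fst_tape_act snd_tape_act tape_read_eq of_nat_diff)
          ultimately show ?thesis
            using Suc.prems u(1) m(1) by (auto intro!: exI[of _ l] exI[of _ "m - 1"])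
        qed
        then show "answers (phase_code (Forward p), map2 tape_act (stay (map tape_read ts)) ts @
            map2 tape_act (map ?f (map tape_read us)) us, []) b"
          unfolding map2_map_reads map2_stay using Suc.prems by (intro Suc.IH) auto
      qed simp
    qed
  qed
qed

text \<open>Cells are compared relative to the heads, since erasing leaves the heads of the additional
  tapes at arbitrary positions. The heads may rest on a cell next to the visited interval.\<close>

definition simulates :: "tape \<Rightarrow> tape \<Rightarrow> bool" where
  "simulates v u \<longleftrightarrow>
    (\<forall>d. fst v (snd v + d) = unmark (fst u (snd u + d))) \<and>
    (\<forall>p. fst u p \<le> num_symbols T) \<and>
    (\<exists>l r. l \<le> r \<and> l - 1 \<le> snd u \<and> snd u \<le> r \<and> (\<forall>p. fst u p \<noteq> 0 \<longleftrightarrow> l \<le> p \<and> p < r))"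

lemma simulates_read: "simulates v u \<Longrightarrow> tape_read v = unmark (tape_read u)"
  unfolding simulates_def tape_read_eq by (metis add.right_neutral)

text \<open>As the head is in the interval or next to it, writing a nonblank leaves no gap. This
  serves both the moves of T and the mark made when T halts.\<close>

lemma interval_extend:
  fixes u :: tape
  assumes "l \<le> r" "l - 1 \<le> snd u" "snd u \<le> r" "\<forall>p. fst u p \<noteq> 0 \<longleftrightarrow> l \<le> p \<and> p < r"
    and "s \<noteq> (0 :: nat)"
  shows "((fst u)(snd u := s)) p \<noteq> 0 \<longleftrightarrow> min l (snd u) \<le> p \<and> p < max r (snd u + 1)"
  using assms(1-3,5) spec[OF assms(4), of p] by auto

lemma simulates_act:
  assumes "simulates v u" "s < num_symbols T"
  shows "simulates (tape_act (s, m) v) (tape_act (mark s, m) u)"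
proof -
  obtain l r where lr: "l \<le> r" "l - 1 \<le> snd u" "snd u \<le> r"
    "\<forall>p. fst u p \<noteq> 0 \<longleftrightarrow> l \<le> p \<and> p < r"
    using assms(1) unfolding simulates_def by blast
  have "mark s \<noteq> 0" "unmark (mark s) = s"
    using assms(2) by (auto simp: mark_def unmark_def)
  then have "\<forall>p. fst (tape_act (mark s, m) u) p \<noteq> 0 \<longleftrightarrow> min l (snd u) \<le> p \<and> p < max r (snd u + 1)"
    using interval_extend[OF lr] by (simp add: fst_tape_act)
  moreover have "fst (tape_act (s, m) v) (snd (tape_act (s, m) v) + d) =
      unmark (fst (tape_act (mark s, m) u) (snd (tape_act (mark s, m) u) + d))" for d
    using assms(1) \<open>unmark (mark s) = s\<close>
    by (auto simp: simulates_def fst_tape_act snd_tape_act add.assoc)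
  moreover have "\<forall>p. fst (tape_act (mark s, m) u) p \<le> num_symbols T"
    using assms by (auto simp: simulates_def fst_tape_act mark_le)
  moreover have "min l (snd u) - 1 \<le> snd (tape_act (mark s, m) u)"
    "snd (tape_act (mark s, m) u) \<le> max r (snd u + 1)"
    by (cases m; auto simp: snd_tape_act)+
  moreover have "min l (snd u) \<le> max r (snd u + 1)"
    using lr(1) by linarith
  ultimately show ?thesis
    unfolding simulates_def
    by (intro conjI exI[of _ "min l (snd u)"] exI[of _ "max r (snd u + 1)"]) auto
qed

lemma list_all2_simulates_act:
  assumes "list_all2 simulates vs us" "length acts = length us" "\<forall>(s, m)\<in>set acts. s < num_symbols T"
  shows "list_all2 simulates (map2 tape_act acts vs)
    (map2 tape_act (map (\<lambda>(s, m). (mark s, m)) acts) us)"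
  using assms
proof (induction vs us arbitrary: acts rule: list_all2_induct)
  case (Cons v vs u us)
  then show ?case
    by (cases acts) (auto simp: simulates_act)
qed simp

lemma map_read_simulates:
  "list_all2 simulates vs us \<Longrightarrow> map tape_read vs = map unmark (map tape_read us)"
  by (induction rule: list_all2_induct) (auto simp: simulates_read)

lemma list_all2_simulates_le:
  "list_all2 simulates vs us \<Longrightarrow> \<forall>u\<in>set us. \<forall>x. fst u x \<le> num_symbols T"
  by (induction rule: list_all2_induct) (auto simp: simulates_def)

lemma list_all2_simulates_ex: "list_all2 simulates vs us \<Longrightarrow> u \<in> set us \<Longrightarrow> \<exists>v. simulates v u"
  by (induction rule: list_all2_induct) auto

text \<open>T may halt with a head on the blank cell left of its visited interval, where
  \<open>Forward\<close> would not move it and \<open>Erase\<close> would miss the interval. The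
  mark puts the head inside, as \<open>answers_Forward\<close> demands.\<close>

lemma simulates_marked:
  assumes "simulates v u" and "u' = tape_act (num_symbols T, Stay) u"
  shows "(\<forall>x. fst u' x \<le> num_symbols T) \<and>
    (\<exists>m. \<exists>l\<le>snd u'. \<forall>x. fst u' x \<noteq> 0 \<longleftrightarrow> l \<le> x \<and> x < snd u' + int m)"
proof -
  obtain l r where lr: "l \<le> r" "l - 1 \<le> snd u" "snd u \<le> r"
    "\<forall>p. fst u p \<noteq> 0 \<longleftrightarrow> l \<le> p \<and> p < r"
    using assms(1) unfolding simulates_def by blast
  have "fst u' x \<noteq> 0 \<longleftrightarrow> min l (snd u) \<le> x \<and> x < max r (snd u + 1)" for x
    using interval_extend[OF lr, of "num_symbols T"] T_pos by (simp add: assms(2) fst_tape_act)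
  moreover have "max r (snd u + 1) = snd u' + int (nat (max r (snd u + 1) - snd u))"
    by (simp add: assms(2) snd_tape_act le_max_iff_disj)
  moreover have "min l (snd u) \<le> snd u'"
    by (simp add: assms(2) snd_tape_act)
  ultimately have "\<exists>m. \<exists>l\<le>snd u'. \<forall>x. fst u' x \<noteq> 0 \<longleftrightarrow> l \<le> x \<and> x < snd u' + int m"
    by metis
  then show ?thesis
    using assms by (auto simp: simulates_def fst_tape_act)
qed

text \<open>The word \<open>w\<close> on the query tape of T has no counterpart in the combined
  machine: T never queries, so what it writes there cannot influence its run.\<close>

lemma answers_Inner:
  assumes "yields T {} UNIV (q, vs, w) t b'" "q < num_states T" "list_all2 simulates vs us"
    and "length us = num_tapes T" "p < num_states S" "p' < num_states S" "S_tapes ts"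
    and "\<And>us'. length us' = num_tapes T \<Longrightarrow> \<forall>u\<in>set us'. \<forall>x. fst u x = 0 \<Longrightarrow>
      answers (phase_code (Outer (if b' then p else p')), ts @ us', []) b"
  shows "answers (phase_code (Inner p p' q), ts @ us, []) b"
  using assms(1-4,8)
proof (induction "(q, vs, w)" t b' arbitrary: q vs w us rule: yields.induct)
  case (halt b' t)
  let ?us = "map (\<lambda>u. tape_act (num_symbols T, Stay) u) us"
  show ?case
  proof (rule answers_Go)
    show "valid (Inner p p' q) (map tape_read ts) (map tape_read us)"
      using halt assms(5-7) list_all2_simulates_le by (intro validI) (auto simp: tape_read_eq)
    show "phase_instr (Inner p p' q) (map tape_read ts) (map tape_read us) =
        Go (phase_code (Forward (if b' then p else p')))
          (stay (map tape_read ts) @ map (\<lambda>_. (num_symbols T, Stay)) (map tape_read us)) None"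
      using halt by (simp add: map_read_simulates)
    have us: "(\<forall>x. fst u' x \<le> num_symbols T) \<and>
        (\<exists>m. \<exists>l\<le>snd u'. \<forall>x. fst u' x \<noteq> 0 \<longleftrightarrow> l \<le> x \<and> x < snd u' + int m)" if "u' \<in> set ?us" for u'
    proof -
      obtain u v where "u' = tape_act (num_symbols T, Stay) u" "simulates v u"
        using \<open>u' \<in> set ?us\<close> list_all2_simulates_ex[OF halt(3)] by fastforce
      then show ?thesis
        using simulates_marked by blast
    qed
    then obtain k where k: "\<And>u'. u' \<in> set ?us \<Longrightarrow>
        \<exists>l\<le>snd u'. \<forall>x. fst u' x \<noteq> 0 \<longleftrightarrow> l \<le> x \<and> x < snd u' + int (k u')"
      by metis
    have "\<exists>l\<le>snd u'. \<exists>m\<le>Max (k ` set ?us). \<forall>x. fst u' x \<noteq> 0 \<longleftrightarrow> l \<le> x \<and> x < snd u' + int m"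
      if u': "u' \<in> set ?us" for u'
    proof -
      have "k u' \<le> Max (k ` set ?us)"
        using u' by (intro Max_ge) auto
      then show ?thesis
        using k[OF u'] by blast
    qed
    then have "answers (phase_code (Forward (if b' then p else p')), ts @ ?us, []) b"
      using us halt assms(5-7) by (intro answers_Forward) (auto simp del: set_map)
    then show "answers (phase_code (Forward (if b' then p else p')),
        map2 tape_act (stay (map tape_read ts)) ts @
        map2 tape_act (map (\<lambda>_. (num_symbols T, Stay)) (map tape_read us)) us, []) b"
      unfolding map2_map_reads map2_stay .
  qed simp
next
  case (step t b')
  show ?case
  proof (cases "delta T q (map tape_read vs)")
    \<comment> \<open>The rule \<open>yields.step\<close> also applies at halting configurations;
      \<open>step\<close> fixes these, so the induction hypothesis is already the claim.\<close>
    case (Halt b'')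
    then have "step T {} (q, vs, w) = (q, vs, w)"
      by (simp add: step_Halt)
    with step show ?thesis
      by metis
  next
    case (Query p p')
    then show ?thesis
      using query_free_T by (auto simp: query_free_def)
  next
    case (Go q' acts out)
    have vs: "map tape_read vs = map unmark (map tape_read us)" and len: "length vs = length us"
      using map_read_simulates[OF step(5)] list_all2_lengthD[OF step(5)] by blast+
    have val: "valid (Inner p p' q) (map tape_read ts) (map tape_read us)"
      using step assms(5-7) list_all2_simulates_le by (intro validI) (auto simp: tape_read_eq)
    have "instr_ok T (delta T q (map tape_read vs))"
      using step(4,6) val unfolding vs
      by (intro wf_oracle_tmD[OF wf_T]) (auto simp: valid_def unmark_less)
    then have ok: "q' < num_states T" "length acts = num_tapes T" "\<forall>(s, m)\<in>set acts. s < num_symbols T"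
      using Go by auto
    show ?thesis
    proof (rule answers_Go[OF val])
      show "phase_instr (Inner p p' q) (map tape_read ts) (map tape_read us) =
          Go (phase_code (Inner p p' q'))
            (stay (map tape_read ts) @ map (\<lambda>(s, m). (mark s, m)) acts) None"
        using Go vs by simp
      show "answers (phase_code (Inner p p' q'), map2 tape_act (stay (map tape_read ts)) ts @
          map2 tape_act (map (\<lambda>(s, m). (mark s, m)) acts) us, []) b"
        unfolding map2_stay
      proof (rule step(3))
        show "step T {} (q, vs, w) = (q', map2 tape_act acts vs, w @ (case out of None \<Rightarrow> [] | Some s \<Rightarrow> [s]))"
          using Go by (simp add: step_def)
      qed (use ok step list_all2_simulates_act in auto)
    qed simp
  qed
qed

section \<open>The query tape and the run of the outer machine\<close>

definition query_tape :: "nat list \<Rightarrow> tape \<Rightarrow> bool" where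
  "query_tape w u \<longleftrightarrow>
    (\<forall>i. fst u (snd u - int (length w) + i) = (if 0 \<le> i \<and> i < int (length w) then w ! nat i else 0))"

text \<open>The head stands just right of the word. Its reading a blank keeps the configuration
  \<open>valid\<close> in phase \<open>Outer\<close>, although S may write letters outside the
  alphabet of T; only words in \<open>V\<close> are known to avoid them.\<close>

lemma query_tape_read:
  assumes "query_tape w u"
  shows "tape_read u = 0"
  using spec[OF assms[unfolded query_tape_def], of "int (length w)"] by (simp add: tape_read_eq)

lemma query_tape_Nil: "query_tape [] u \<longleftrightarrow> (\<forall>x. fst u x = 0)"
  unfolding query_tape_def by (auto dest: spec[of _ "x - snd u" for x])

lemma query_tape_append:
  assumes "query_tape w u"
  shows "query_tape (w @ [s]) (tape_act (s, Right) u)"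
  unfolding query_tape_def
proof
  fix i
  show "fst (tape_act (s, Right) u) (snd (tape_act (s, Right) u) - int (length (w @ [s])) + i) =
      (if 0 \<le> i \<and> i < int (length (w @ [s])) then (w @ [s]) ! nat i else 0)"
    using spec[OF assms[unfolded query_tape_def], of i]
    by (auto simp: fst_tape_act snd_tape_act nth_append)
qed

text \<open>Letters of a query are positive, so the nonblank cells are exactly those of the word, an
  interval as \<open>simulates\<close> demands. With its head at the start, the query tape thus
  serves as the input tape of T.\<close>

lemma simulates_input:
  assumes "query_tape w (g, k)" "\<forall>s\<in>set w. 0 < s \<and> s < num_symbols T"
  shows "simulates (input_tape w) (g, k - int (length w))"
proof -
  let ?k = "k - int (length w)"
  have g: "g (?k + i) = (if 0 \<le> i \<and> i < int (length w) then w ! nat i else 0)" for i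
    using assms(1) by (simp add: query_tape_def)
  have w: "0 < w ! nat i \<and> w ! nat i < num_symbols T" if "0 \<le> i" "i < int (length w)" for i
    using assms(2) that by simp
  have g': "g p = (if ?k \<le> p \<and> p < k then w ! nat (p - ?k) else 0)" for p
    using g[of "p - ?k"] by simp
  show ?thesis
    unfolding simulates_def
  proof (intro conjI allI)
    show "fst (input_tape w) (snd (input_tape w) + d) = unmark (fst (g, ?k) (snd (g, ?k) + d))" for d
      using w[of d] g[of d] T_pos
      by (cases "0 \<le> d \<and> d < int (length w)") (auto simp: input_tape_def unmark_def)
    show "fst (g, ?k) p \<le> num_symbols T" for p
      using w[of "p - ?k"] by (cases "?k \<le> p \<and> p < k") (auto simp: g' less_imp_le)
    show "\<exists>l r. l \<le> r \<and> l - 1 \<le> snd (g, ?k) \<and> snd (g, ?k) \<le> r \<and>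
        (\<forall>p. fst (g, ?k) p \<noteq> 0 \<longleftrightarrow> l \<le> p \<and> p < r)"
    proof (rule exI[of _ ?k], rule exI[of _ k], intro conjI allI)
      show "fst (g, ?k) p \<noteq> 0 \<longleftrightarrow> ?k \<le> p \<and> p < k" for p
        using w[of "p - ?k"] by (auto simp: g')
    qed simp_all
  qed
qed

lemma simulates_blank: "\<forall>x. fst u x = 0 \<Longrightarrow> simulates blank_tape u"
  by (auto simp: simulates_def blank_tape_def unmark_def intro!: exI[of _ "snd u"])

text \<open>\<open>j\<close> letters remain at or to the left of the head. Since letters are
  positive, the first blank met is the cell before the word, reached at
  \<open>j = 0\<close>.\<close>

lemma answers_Rewind:
  assumes "p < num_states S" "p' < num_states S" "S_tapes ts" "Suc (length bs) = num_tapes T"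
    and "\<forall>u\<in>set bs. \<forall>x. fst u x = 0"
    and "query_tape w (g, k)" "\<forall>s\<in>set w. 0 < s \<and> s < num_symbols T"
    and "j \<le> length w"
    and "answers (phase_code (Inner p p' 0), ts @ (g, k - int (length w)) # bs, []) b"
  shows "answers (phase_code (Rewind p p'), ts @ (g, k - int (length w) + int j - 1) # bs, []) b"
  using assms(8)
proof (induction j)
  let ?k = "k - int (length w)"
  have g: "g (?k + i) = (if 0 \<le> i \<and> i < int (length w) then w ! nat i else 0)" for i
    using assms(6) by (simp add: query_tape_def)
  have le: "g (?k + i) \<le> num_symbols T" for i
    using assms(7) nth_mem[of "nat i" w] by (auto simp: g nat_less_iff less_imp_le)
  have val: "valid (Rewind p p') (map tape_read ts) (map tape_read ((g, ?k + i) # bs))" for i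
    using assms(1-5) le[of i] by (intro validI) (auto simp: tape_read_eq)
  {
    case 0
    have g0: "g (?k - 1) = 0"
      using g[of "- 1"] by simp
    have val: "valid (Rewind p p') (map tape_read ts) (map tape_read ((g, ?k + int 0 - 1) # bs))"
      using val[of "- 1"] by simp
    show ?case
    proof (rule answers_Go[OF val])
      show "phase_instr (Rewind p p') (map tape_read ts) (map tape_read ((g, ?k + int 0 - 1) # bs)) =
          Go (phase_code (Inner p p' 0))
            (stay (map tape_read ts) @ (0, Right) # stay (map tape_read bs)) None"
        using g0 by simp
      have "g(?k - 1 := 0) = g"
        using g0 by (simp add: fun_upd_idem)
      then show "answers (phase_code (Inner p p' 0), map2 tape_act (stay (map tape_read ts)) ts @
          map2 tape_act ((0, Right) # stay (map tape_read bs)) ((g, ?k + int 0 - 1) # bs), []) b"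
        using assms(9) by simp
    qed simp
  next
    case (Suc j)
    have gj: "g (?k + int j) = w ! j" "w ! j \<noteq> 0"
      using g[of "int j"] assms(7) Suc.prems by auto
    have k: "?k + int (Suc j) - 1 = ?k + int j"
      by simp
    have val: "valid (Rewind p p') (map tape_read ts) (map tape_read ((g, ?k + int j) # bs))"
      by (rule val)
    show ?case
      unfolding k
    proof (rule answers_Go[OF val])
      show "phase_instr (Rewind p p') (map tape_read ts) (map tape_read ((g, ?k + int j) # bs)) =
          Go (phase_code (Rewind p p'))
            (stay (map tape_read ts) @ (w ! j, Left) # stay (map tape_read bs)) None"
        using gj by simp
      have "g(?k + int j := w ! j) = g"
        using gj by (simp add: fun_upd_idem)
      then show "answers (phase_code (Rewind p p'), map2 tape_act (stay (map tape_read ts)) ts @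
          map2 tape_act ((w ! j, Left) # stay (map tape_read bs)) ((g, ?k + int j) # bs), []) b"
        using Suc.IH Suc.prems by simp
    qed simp
  }
qed

lemma answers_Outer:
  assumes "yields S Orac V (q, ts, w) t b" "q < num_states S" "S_tapes ts" "query_tape w u"
    and "Suc (length bs) = num_tapes T" "\<forall>u\<in>set bs. \<forall>x. fst u x = 0"
    and V: "\<And>w. w \<in> V \<Longrightarrow> \<exists>t. yields T {} UNIV (initial_config T w) t (w \<in> Orac)"
      "\<And>w s. w \<in> V \<Longrightarrow> s \<in> set w \<Longrightarrow> 0 < s \<and> s < num_symbols T"
  shows "answers (phase_code (Outer q), ts @ u # bs, []) b"
  using assms(1-6)
proof (induction "(q, ts, w)" t b arbitrary: q ts w u bs rule: yields.induct)
  case (halt b t)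
  have val: "valid (Outer q) (map tape_read ts) (map tape_read (u # bs))"
    using halt by (intro validI) (auto simp: tape_read_eq query_tape_read[unfolded tape_read_eq])
  have "delta combined (phase_code (Outer q)) (map tape_read (ts @ u # bs)) = Halt b"
    unfolding delta_combined[OF val] using halt by simp
  then show ?case
    unfolding answers_def by (blast intro: yields_Halt)
next
  case (step t b)
  have val: "valid (Outer q) (map tape_read ts) (map tape_read (u # bs))"
    using step by (intro validI) (auto simp: tape_read_eq query_tape_read[unfolded tape_read_eq])
  have ok: "instr_ok S (delta S q (map tape_read ts))"
    using step(4,5) by (intro wf_oracle_tmD[OF wf_S]) (auto simp: S_tapes_def tape_read_eq)
  show ?case
  proof (cases "delta S q (map tape_read ts)")
    case (Halt b')
    then have "step S Orac (q, ts, w) = (q, ts, w)"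
      by (simp add: step_Halt)
    with step show ?thesis
      by metis
  next
    case (Query p p')
    then have "w \<in> V" and p: "p < num_states S" "p' < num_states S"
      using step(1)[of p p'] ok by auto
    obtain g k where u: "u = (g, k)"
      by fastforce
    have read: "g k = 0"
      using step(6) query_tape_read[of w u] by (simp add: u)
    obtain t' where t': "yields T {} UNIV (initial_config T w) t' (w \<in> Orac)"
      using V(1)[OF \<open>w \<in> V\<close>] by blast
    have "answers (phase_code (Inner p p' 0), ts @ (g, k - int (length w)) # bs, []) b"
    proof (rule answers_Inner)
      show "yields T {} UNIV
          (0, input_tape w # replicate (num_tapes T - 1) blank_tape, []) t' (w \<in> Orac)"
        using t' by (simp add: initial_config_def)
      have "list_all2 simulates (replicate (num_tapes T - 1) blank_tape) bs"
        using step(7,8) by (auto simp: list_all2_conv_all_nth intro!: simulates_blank)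
      then show "list_all2 simulates (input_tape w # replicate (num_tapes T - 1) blank_tape)
          ((g, k - int (length w)) # bs)"
        using simulates_input[of w g k] step(6) V(2)[OF \<open>w \<in> V\<close>] by (simp add: u)
    next
      \<comment> \<open>Erasing leaves blank tapes with heads at unknown positions. This is an empty
        query tape, and the induction hypothesis applies since \<open>u\<close> and
        \<open>bs\<close> are arbitrary in it.\<close>
      fix us' :: "tape list"
      assume us': "length us' = num_tapes T" "\<forall>u\<in>set us'. \<forall>x. fst u x = 0"
      then obtain u' bs' where "us' = u' # bs'"
        using T_pos by (cases us') auto
      then show "answers (phase_code (Outer (if w \<in> Orac then p else p')), ts @ us', []) b"
        using us' step(3)[of "if w \<in> Orac then p else p'" ts "[]" u' bs'] step(5) p Query
        by (simp add: step_def query_tape_Nil)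
    qed (use T_pos p step(5,7) in auto)
    then have rewind: "answers (phase_code (Rewind p p'), ts @ (g, k - 1) # bs, []) b"
      using answers_Rewind[of p p' ts bs w g k "length w" b] step V(2)[OF \<open>w \<in> V\<close>] p
      by (simp add: u)
    show ?thesis
    proof (rule answers_Go[OF val])
      show "phase_instr (Outer q) (map tape_read ts) (map tape_read (u # bs)) =
          Go (phase_code (Rewind p p'))
            (stay (map tape_read ts) @ (0, Left) # stay (map tape_read bs)) None"
        using Query by simp
      have "g(k := 0) = g"
        using read by (simp add: fun_upd_idem)
      then show "answers (phase_code (Rewind p p'), map2 tape_act (stay (map tape_read ts)) ts @
          map2 tape_act ((0, Left) # stay (map tape_read bs)) (u # bs), []) b"
        using rewind by (simp add: u)
    qed simp
  next
    case (Go q' acts out)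
    let ?a = "case out of None \<Rightarrow> (0, Stay) | Some s \<Rightarrow> (s, Right)"
    show ?thesis
    proof (rule answers_Go[OF val])
      show "phase_instr (Outer q) (map tape_read ts) (map tape_read (u # bs)) =
          Go (phase_code (Outer q')) (acts @ ?a # stay (map tape_read bs)) None"
        using Go by simp
      show "length acts = length ts"
        using Go ok step(5) by (simp add: S_tapes_def)
      have "S_tapes (map2 tape_act acts ts)"
        using Go ok step(5) by (simp add: S_tapes_act)
      moreover have "query_tape (w @ (case out of None \<Rightarrow> [] | Some s \<Rightarrow> [s])) (tape_act ?a u)"
      proof (cases out)
        case None
        have "tape_act (0, Stay) u = u"
          using query_tape_read[OF step(6)] by (cases u) auto
        then show ?thesis
          using None step(6) by simp
      qed (use query_tape_append[OF step(6)] in simp)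
      moreover have "step S Orac (q, ts, w) =
          (q', map2 tape_act acts ts, w @ (case out of None \<Rightarrow> [] | Some s \<Rightarrow> [s]))"
        using Go by (simp add: step_def)
      ultimately have "answers (phase_code (Outer q'), map2 tape_act acts ts @ tape_act ?a u # bs, []) b"
        using step(3,7,8) Go ok by auto
      then show "answers (phase_code (Outer q'), map2 tape_act acts ts @
          map2 tape_act (?a # stay (map tape_read bs)) (u # bs), []) b"
        by simp
    qed
  qed
qed

theorem halts_combined:
  assumes "yields S Orac V (initial_config S w) t b" "\<forall>s\<in>set w. s < num_symbols S"
    and V: "\<And>w. w \<in> V \<Longrightarrow> \<exists>t. yields T {} UNIV (initial_config T w) t (w \<in> Orac)"
      "\<And>w s. w \<in> V \<Longrightarrow> s \<in> set w \<Longrightarrow> 0 < s \<and> s < num_symbols T"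
  shows "\<exists>t. halts_within combined {} w t b"
proof -
  let ?ts = "input_tape w # replicate (num_tapes S - 1) blank_tape"
  let ?bs = "replicate (num_tapes T - 1) blank_tape"
  have "S_tapes ?ts"
    using assms(2) S_pos by (auto simp: S_tapes_def input_tape_def blank_tape_def)
  then have "answers (phase_code (Outer 0), ?ts @ blank_tape # ?bs, []) b"
    using assms(1) S_pos T_pos
    by (intro answers_Outer[OF _ _ _ _ _ _ V]) (auto simp: initial_config_def query_tape_Nil blank_tape_def)
  moreover have "phase_code (Outer 0) = 0"
    by (simp add: phase_code.simps prod_encode_def)
  moreover have "num_tapes S + num_tapes T - 1 = (num_tapes S - 1) + Suc (num_tapes T - 1)"
    using S_pos T_pos by simp
  ultimately have "answers (initial_config combined w) b"
    by (simp only: initial_config_def combined_simps replicate_add replicate_Suc append_Cons)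
  then show ?thesis
    unfolding answers_def by (blast intro: halts_within_if_yields)
qed

end

lemma decidable_by_oracle:
  assumes "wf_oracle_tm S" "admits_inputs S P"
    and S: "\<And>x. \<exists>t. yields S (oracle_for Q) (range (coding Q))
      (initial_config S (coding P x)) t (x \<in> yes_instances P)"
    and "decidable Q"
  shows "decidable P"
proof -
  obtain T where T: "wf_oracle_tm T" "query_free T" "admits_inputs T Q"
    and halts: "\<And>y. \<exists>t. halts_within T {} (coding Q y) t (y \<in> yes_instances Q)"
    using assms(4) by (auto simp: decidable_def)
  interpret oracle_elimination S T
    using assms(1) T by unfold_locales
  have V: "\<exists>t. yields T {} UNIV (initial_config T w) t (w \<in> oracle_for Q)"
    if "w \<in> range (coding Q)" for w
  proof -
    \<comment> \<open>\<open>coding Q\<close> is not assumed injective, so a preimage is chosen that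
      is a yes-instance whenever some preimage is.\<close>
    obtain y where "w = coding Q y" "w \<in> oracle_for Q \<longrightarrow> y \<in> yes_instances Q"
      using \<open>w \<in> range (coding Q)\<close> by (cases "w \<in> oracle_for Q") (force simp: oracle_for_def)+
    then have w: "w = coding Q y" "w \<in> oracle_for Q \<longleftrightarrow> y \<in> yes_instances Q"
      by (auto simp: oracle_for_def)
    show ?thesis
      using halts[of y] unfolding w(2) unfolding w(1) halts_within_def by (blast intro: yields_if_halting)
  qed
  have "\<exists>t. halts_within combined {} (coding P x) t (x \<in> yes_instances P)" for x
  proof -
    obtain t where "yields S (oracle_for Q) (range (coding Q))
        (initial_config S (coding P x)) t (x \<in> yes_instances P)"
      using S by blast
    then show ?thesis
      by (rule halts_combined) (use assms(2) T(3) V in \<open>auto simp: admits_inputs_def\<close>)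
  qed
  moreover have "admits_inputs combined P"
    using assms(2) by (auto simp: admits_inputs_def less_max_iff_disj)
  ultimately show ?thesis
    using wf_combined query_free_combined by (auto simp: decidable_def)
qed

section \<open>The two reductions\<close>

text \<open>On input $1^n$, one sweep to the right and one back to the left write the codes of
  $ab^nc$ and $ab^nd$ to the query tape.\<close>

definition membership_machine :: oracle_tm where
  "membership_machine =
    \<lparr> num_states = 8, num_symbols = 7, num_tapes = 1,
      delta = (\<lambda>q ss. let x = hd ss in
        if q = 0 then Go 1 [(x, Stay)] (Some 1)
        else if q = 1 then
          if x = 0 then Go 2 [(x, Left)] (Some 3) else Go 1 [(x, Right)] (Some 2)
        else if q = 2 then Go 3 [(x, Stay)] (Some 6)
        else if q = 3 then Go 4 [(x, Stay)] (Some 1)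
        else if q = 4 then
          if x = 0 then Go 5 [(x, Stay)] (Some 4) else Go 4 [(x, Left)] (Some 2)
        else if q = 5 then Query 6 7
        else Halt (q = 6)) \<rparr>"

lemma wf_membership_machine: "wf_oracle_tm membership_machine"
proof -
  have "instr_ok membership_machine (delta membership_machine q ss)"
    if len: "length ss = 1" and lt: "\<forall>s\<in>set ss. s < 7" for q ss
  proof -
    obtain x where "ss = [x]" "x < 7"
      using len lt by (cases ss) auto
    then show ?thesis
      by (simp add: membership_machine_def Let_def)
  qed
  then show ?thesis
    by (simp add: wf_oracle_tm_def) (simp add: membership_machine_def)
qed

lemma coding_membership_query:
  "coding (word_problem X) (ga # replicate n gb @ [gc], ga # replicate n gb @ [gd]) =
    1 # replicate n 2 @ [3, 6, 1] @ replicate n 2 @ [4]"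
  by (simp add: word_problem_def)

lemma inj_gen_code: "inj gen_code"
proof (rule injI)
  fix x y
  show "gen_code x = gen_code y \<Longrightarrow> x = y"
    by (cases x; cases y) simp_all
qed

lemma gen_code_bounds: "0 < gen_code x" "gen_code x < 6"
  by (cases x; simp)+

text \<open>The separator 6 exceeds all letter codes, so the first 6 marks the cut. Injectivity is
  needed because the oracle is an image: a coded pair might otherwise belong to it on account of
  another pair.\<close>

lemma inj_coding_word_problem: "inj (coding (word_problem X))"
proof (rule injI)
  fix p q :: "gen list \<times> gen list"
  obtain u v u' v' where pq: "p = (u, v)" "q = (u', v')"
    by fastforce
  have split: "takeWhile ((\<noteq>) 6) (map gen_code u @ 6 # map gen_code v) = map gen_code u"
    "dropWhile ((\<noteq>) 6) (map gen_code u @ 6 # map gen_code v) = 6 # map gen_code v" for u v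
    using gen_code_bounds(2) by (simp_all add: takeWhile_append dropWhile_append) (metis less_irrefl)+
  assume "coding (word_problem X) p = coding (word_problem X) q"
  then have eq: "map gen_code u @ 6 # map gen_code v = map gen_code u' @ 6 # map gen_code v'"
    by (simp add: word_problem_def pq)
  from arg_cong[OF eq, of "takeWhile ((\<noteq>) 6)"] arg_cong[OF eq, of "dropWhile ((\<noteq>) 6)"]
  have "map gen_code u = map gen_code u'" "map gen_code v = map gen_code v'"
    by (simp_all only: split list.inject)
  then show "p = q"
    using inj_gen_code by (simp add: pq inj_map_eq_map)
qed

lemma membership_query_iff:
  "1 # replicate n 2 @ [3, 6, 1] @ replicate n 2 @ [4] \<in> oracle_for (word_problem X) \<longleftrightarrow> n \<in> X"
proof -
  have "M_elem X (ga # replicate n gb @ [gc]) = M_elem X (ga # replicate n gb @ [gd]) \<longleftrightarrow> n \<in> X"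
    by (simp add: M_elem_eq_iff normal_form_relation canon_def del: normal_form.simps)
  then show ?thesis
    unfolding oracle_for_def coding_membership_query[of X, symmetric]
      inj_image_mem_iff[OF inj_coding_word_problem]
    by (simp add: word_problem_def)
qed

lemma membership_machine_yields:
  "yields membership_machine (oracle_for (word_problem X)) (range (coding (word_problem X)))
    (initial_config membership_machine (replicate n 1)) (2 * n + 7) (n \<in> X)"
proof -
  define f where "f = (\<lambda>p. if 0 \<le> p \<and> p < int n then 1 else 0 :: nat)"
  let ?Y = "yields membership_machine (oracle_for (word_problem X)) (range (coding (word_problem X)))"
  let ?pre = "1 # replicate n 2 @ [3, 6, 1]"
  \<comment> \<open>Each instruction writes back the symbol read, so the tape contents
    \<open>f\<close> never change.\<close>
  have go: "?Y (q, [(f, h)], w) (Suc t) b"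
    if "delta membership_machine q [f h] = Go p [(f h, m)] (Some s)"
      "?Y (p, [(f, h + move_offset m)], w @ [s]) t b" for q h w p m s t b
    using that by (intro yields_Go[where acts = "[(f h, m)]" and out = "Some s"]) simp_all
  have final: "?Y (5, [(f, h)], ?pre @ replicate n 2 @ [4]) (Suc 0) (n \<in> X)" for h
  proof (rule yields_Query)
    show "delta membership_machine 5 (map tape_read [(f, h)]) = Query 6 7"
      by (simp add: membership_machine_def)
    show "?pre @ replicate n 2 @ [4] \<in> range (coding (word_problem X))"
      using rangeI[of "coding (word_problem X)", of "(ga # replicate n gb @ [gc], ga # replicate n gb @ [gd])"]
      unfolding coding_membership_query by simp
    show "?Y (if ?pre @ replicate n 2 @ [4] \<in> oracle_for (word_problem X) then 6 else 7,
        [(f, h)], []) 0 (n \<in> X)"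
      using membership_query_iff[of n X]
      by (intro yields_Halt) (simp add: membership_machine_def)
  qed
  \<comment> \<open>The run is assembled from its end: \<open>i\<close> counts the cells still to be
    crossed, here and in \<open>forward\<close>.\<close>
  have backward: "?Y (4, [(f, int i - 1)], ?pre @ replicate (n - i) 2) (i + 2) (n \<in> X)" if "i \<le> n" for i
    using that
  proof (induction i)
    case 0
    have "?Y (4, [(f, int 0 - 1)], ?pre @ replicate (n - 0) 2) (Suc (Suc 0)) (n \<in> X)"
    proof (rule go)
      show "delta membership_machine 4 [f (int 0 - 1)] = Go 5 [(f (int 0 - 1), Stay)] (Some 4)"
        by (simp add: membership_machine_def f_def)
    qed (use final in simp)
    then show ?case
      by (simp only: add_0 numeral_2_eq_2)
  next
    case (Suc i)
    show ?case
      unfolding add_Suc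
    proof (rule go)
      show "delta membership_machine 4 [f (int (Suc i) - 1)] = Go 4 [(f (int (Suc i) - 1), Left)] (Some 2)"
        using Suc.prems by (simp add: membership_machine_def f_def)
      have "n - i = Suc (n - Suc i)"
        using Suc.prems by simp
      then have "replicate (n - i) (2::nat) = replicate (n - Suc i) 2 @ [2]"
        by (simp add: replicate_append_same)
      then show "?Y (4, [(f, int (Suc i) - 1 + move_offset Left)], (?pre @ replicate (n - Suc i) 2) @ [2])
          (i + 2) (n \<in> X)"
        using Suc by simp
    qed
  qed
  have forward: "?Y (1, [(f, int (n - i))], 1 # replicate (n - i) 2) (i + n + 5) (n \<in> X)" if "i \<le> n" for i
    using that
  proof (induction i)
    case 0
    have "?Y (3, [(f, int n - 1)], 1 # replicate n 2 @ [3, 6]) (Suc (n + 2)) (n \<in> X)"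
    proof (rule go)
      show "delta membership_machine 3 [f (int n - 1)] = Go 4 [(f (int n - 1), Stay)] (Some 1)"
        by (simp add: membership_machine_def)
    qed (use backward[of n] in simp)
    then have "?Y (2, [(f, int n - 1)], 1 # replicate n 2 @ [3]) (Suc (Suc (n + 2))) (n \<in> X)"
      by (intro go[of 2 _ 3 Stay 6]) (simp_all add: membership_machine_def)
    then have "?Y (1, [(f, int n)], 1 # replicate n 2) (Suc (Suc (Suc (n + 2)))) (n \<in> X)"
      by (intro go[of 1 _ 2 Left 3]) (simp_all add: membership_machine_def f_def)
    then show ?case
      by (simp add: eval_nat_numeral)
  next
    case (Suc i)
    show ?case
      unfolding add_Suc
    proof (rule go)
      show "delta membership_machine 1 [f (int (n - Suc i))] = Go 1 [(f (int (n - Suc i)), Right)] (Some 2)"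
        using Suc.prems by (simp add: membership_machine_def f_def)
      have "n - i = Suc (n - Suc i)"
        using Suc.prems by simp
      then have "replicate (n - i) (2::nat) = replicate (n - Suc i) 2 @ [2]"
        "int (n - i) = int (n - Suc i) + 1"
        by (simp_all add: replicate_append_same)
      then show "?Y (1, [(f, int (n - Suc i) + move_offset Right)], (1 # replicate (n - Suc i) 2) @ [2])
          (i + n + 5) (n \<in> X)"
        using Suc by simp
    qed
  qed
  have "?Y (0, [(f, 0)], []) (Suc (n + n + 5)) (n \<in> X)"
  proof (rule go)
    show "delta membership_machine 0 [f 0] = Go 1 [(f 0, Stay)] (Some 1)"
      by (simp add: membership_machine_def)
  qed (use forward[of n] in simp)
  moreover have "initial_config membership_machine (replicate n 1) = (0, [(f, 0)], [])"
    by (auto simp: initial_config_def input_tape_def membership_machine_def f_def fun_eq_iff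
        nat_less_iff)
  ultimately show ?thesis
    by (auto elim: yields_mono)
qed

text \<open>States 0 and 1 copy the first word to tape 1 and rewind. State 3 is entered after a common
  factor $ab^i$, with $1^i$ on the query tape; the instruction \<open>Query 2 2\<close> ignores the answer and only
  serves to empty the query tape.\<close>

definition word_machine :: oracle_tm where
  "word_machine =
    \<lparr> num_states = 6, num_symbols = 7, num_tapes = 2,
      delta = (\<lambda>q ss. let x = hd ss; y = last ss in
        if q = 0 then
          if x = 6 then Go 1 [(x, Stay), (y, Left)] None else Go 0 [(x, Right), (x, Right)] None
        else if q = 1 then
          if y = 0 then Go 2 [(x, Right), (y, Right)] None else Go 1 [(x, Stay), (y, Left)] None
        else if q = 2 then
          if x \<noteq> y then Halt False
          else if x = 0 then Halt True
          else Go (if x = 1 then 3 else 2) [(x, Right), (y, Right)] None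
        else if q = 3 then
          if x = y then if x = 2 then Go 3 [(x, Right), (y, Right)] (Some 1) else Query 2 2
          else if {x, y} = {3, 4} then Query 4 5
          else if {x, y} = {3, 5} then Query 5 4
          else Halt False
        else if q = 4 then Go 2 [(x, Right), (y, Right)] None
        else Halt False) \<rparr>"

lemma wf_word_machine: "wf_oracle_tm word_machine"
proof -
  have "instr_ok word_machine (delta word_machine q ss)"
    if len: "length ss = 2" and lt: "\<forall>s\<in>set ss. s < 7" for q ss
  proof -
    obtain x y where "ss = [x, y]" "x < 7" "y < 7"
      using len lt by (auto simp: length_Suc_conv numeral_2_eq_2)
    then show ?thesis
      by (simp add: word_machine_def Let_def)
  qed
  then show ?thesis
    by (simp add: wf_oracle_tm_def) (simp add: word_machine_def)
qed

text \<open>Only cells from the head rightwards are described: the comparison never moves left, and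
  the first word and the separator stand left of the second word.\<close>

definition reads_from :: "(int \<Rightarrow> nat) \<Rightarrow> int \<Rightarrow> nat list \<Rightarrow> bool" where
  "reads_from f h w \<longleftrightarrow> (\<forall>i. f (h + int i) = (if i < length w then w ! i else 0))"

lemma reads_from_Nil: "reads_from f h [] \<Longrightarrow> f h = 0"
  unfolding reads_from_def by (metis add.right_neutral list.size(3) not_less_zero of_nat_0)

lemma reads_from_Cons:
  assumes "reads_from f h (x # w)"
  shows "f h = x" "reads_from f (h + 1) w"
  using spec[OF assms[unfolded reads_from_def], of 0]
    spec[OF assms[unfolded reads_from_def], of "Suc i" for i]
  by (auto simp: reads_from_def add.assoc)

section \<open>Correctness and running time of the comparison scan\<close>

context
  fixes X :: "nat set"
begin

abbreviation word_yields :: "config \<Rightarrow> nat \<Rightarrow> bool \<Rightarrow> bool" where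
  "word_yields \<equiv> yields word_machine (oracle_for (unary_membership_problem X))
    (range (coding (unary_membership_problem X)))"

lemma word_yields_Go:
  assumes "delta word_machine q [f h, g k] = Go p [(s, m), (s', m')] out"
    and "word_yields (p, [tape_act (s, m) (f, h), tape_act (s', m') (g, k)],
      w @ (case out of None \<Rightarrow> [] | Some s \<Rightarrow> [s])) t b"
  shows "word_yields (q, [(f, h), (g, k)], w) (Suc t) b"
  using assms(2) by (intro yields_Go[where acts = "[(s, m), (s', m')]" and out = out])
    (simp_all add: assms(1))

lemma word_yields_advance:
  assumes "delta word_machine q [f h, g k] = Go p [(f h, Right), (g k, Right)] out"
    and "word_yields (p, [(f, h + 1), (g, k + 1)], w @ (case out of None \<Rightarrow> [] | Some s \<Rightarrow> [s])) t b"
  shows "word_yields (q, [(f, h), (g, k)], w) (Suc t) b"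
  using assms(2) by (intro yields_Go[where acts = "[(f h, Right), (g k, Right)]" and out = out])
    (simp_all add: assms(1))

lemma word_yields_Query:
  assumes "delta word_machine q [f h, g k] = Query p p'"
    and "word_yields (if i \<in> X then p else p', [(f, h), (g, k)], []) t b"
  shows "word_yields (q, [(f, h), (g, k)], replicate i 1) (Suc t) b"
proof (rule yields_Query)
  have "coding (unary_membership_problem X) = (\<lambda>n. replicate n 1)"
    by (simp add: unary_membership_problem_def)
  then have "replicate i 1 \<in> oracle_for (unary_membership_problem X) \<longleftrightarrow> i \<in> X"
    by (auto simp: oracle_for_def unary_membership_problem_def replicate_eq_replicate)
  then show "word_yields (if replicate i 1 \<in> oracle_for (unary_membership_problem X) then p else p',
      [(f, h), (g, k)], []) t b"
    using assms(2) by simp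
qed (use assms(1) in \<open>auto simp: unary_membership_problem_def\<close>)

text \<open>State 2 stands for \<open>None\<close>, state 3 with $1^i$ on the query tape for
  \<open>Some i\<close>. A letter costs at most two steps, a query and an advance; the extra step is
  the query that empties the query tape when both words end in state 3.\<close>

lemma word_machine_compares:
  assumes "reads_from f h (map gen_code v)" "reads_from g k (map gen_code u)"
  shows "word_yields (case s of None \<Rightarrow> 2 | Some i \<Rightarrow> 3, [(f, h), (g, k)],
      case s of None \<Rightarrow> [] | Some i \<Rightarrow> replicate i 1)
    (2 * length u + 1) (normal_form X s u = normal_form X s v)"
  using assms
proof (induction u arbitrary: v s h k)
  case Nil
  have g: "g k = 0"
    using Nil(2) reads_from_Nil by simp
  show ?case
  proof (cases v)
    case Nil
    then have f: "f h = 0"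
      using \<open>reads_from f h _\<close> reads_from_Nil by simp
    have None: "word_yields (2, [(f, h), (g, k)], []) t True" for t
      by (rule yields_Halt) (simp add: f g word_machine_def)
    show ?thesis
    proof (cases s)
      case (Some i)
      have "delta word_machine 3 [f h, g k] = Query 2 2"
        by (simp add: f g word_machine_def)
      then have "word_yields (3, [(f, h), (g, k)], replicate i 1) (Suc 0) True"
        by (rule word_yields_Query) (simp add: None)
      then show ?thesis
        by (simp add: Some \<open>v = []\<close>)
    qed (simp add: None \<open>v = []\<close>)
  next
    case (Cons y v')
    then have f: "f h = gen_code y"
      using \<open>reads_from f h _\<close> reads_from_Cons(1) by simp
    have "word_yields (case s of None \<Rightarrow> 2 | Some i \<Rightarrow> 3, [(f, h), (g, k)],
        case s of None \<Rightarrow> [] | Some i \<Rightarrow> replicate i 1) 1 False"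
      by (rule yields_Halt) (cases y; simp add: f g word_machine_def doubleton_eq_iff split: option.split)
    then show ?thesis
      by (simp add: Cons)
  qed
next
  case (Cons x u)
  have g: "g k = gen_code x" "reads_from g (k + 1) (map gen_code u)"
    using Cons.prems(2) reads_from_Cons by auto
  show ?case
  proof (cases v)
    case Nil
    then have f: "f h = 0"
      using Cons.prems(1) reads_from_Nil by simp
    have "word_yields (case s of None \<Rightarrow> 2 | Some i \<Rightarrow> 3, [(f, h), (g, k)],
        case s of None \<Rightarrow> [] | Some i \<Rightarrow> replicate i 1) (2 * length (x # u) + 1) False"
      by (rule yields_Halt) (cases x; simp add: f g word_machine_def doubleton_eq_iff split: option.split)
    then show ?thesis
      by (simp add: Nil)
  next
    case v: (Cons y v')
    have f: "f h = gen_code y" "reads_from f (h + 1) (map gen_code v')"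
      using Cons.prems(1) reads_from_Cons v by auto
    note IH = Cons.IH[OF f(2) g(2)]
    \<comment> \<open>This is used twice: directly from \<open>None\<close>, and from
      \<open>Some i\<close> after \<open>Query 2 2\<close>, which leaves the heads in place so that
      state 2 reads the same letter again.\<close>
    have equal: "word_yields (2, [(f, h), (g, k)], []) (2 * length u + 2)
        (normal_form X (scan None x) u = normal_form X (scan None x) v')" if "x = y"
    proof -
      have "word_yields (2, [(f, h), (g, k)], []) (Suc (2 * length u + 1))
          (normal_form X (scan None x) u = normal_form X (scan None x) v')"
      proof (rule word_yields_advance)
        show "delta word_machine 2 [f h, g k] =
            Go (if x = ga then 3 else 2) [(f h, Right), (g k, Right)] None"
          using that by (cases x) (simp_all add: f g word_machine_def)
        show "word_yields (if x = ga then 3 else 2, [(f, h + 1), (g, k + 1)],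
            [] @ (case None of None \<Rightarrow> [] | Some s \<Rightarrow> [s])) (2 * length u + 1)
            (normal_form X (scan None x) u = normal_form X (scan None x) v')"
          using IH[of "scan None x"] by (cases x) simp_all
      qed
      then show ?thesis
        by simp
    qed
    show ?thesis
    proof (cases s)
      case None
      show ?thesis
      proof (cases "x = y")
        case True
        show ?thesis
          using yields_mono[OF equal[OF True]] by (simp add: None v True canon_def)
      next
        case False
        then have "gen_code y \<noteq> gen_code x"
          using inj_gen_code by (auto dest: injD)
        then have "word_yields (2, [(f, h), (g, k)], []) (2 * length (x # u) + 1) False"
          by (intro yields_Halt) (simp add: f g word_machine_def)
        then show ?thesis
          using False by (simp add: None v canon_def)
      qed
    next
      case (Some i)
      let ?eq = "normal_form X None u = normal_form X None v'"
      \<comment> \<open>\<open>Y\<close> is the set in which \<open>i\<close> must lie for the two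
        letters to agree: \<open>X\<close> for $c$ and $d$, its complement for $c$ and $e$. State 4
        continues, state 5 rejects.\<close>
      have query: "word_yields (3, [(f, h), (g, k)], replicate i 1) (2 * length u + 3) (i \<in> Y \<and> ?eq)"
        if "delta word_machine 3 [f h, g k] = Query p p'"
          "(p, p') = (if Y = X then (4, 5) else (5, 4))" "Y = X \<or> Y = - X" for p p' Y
      proof -
        have "word_yields (4, [(f, h), (g, k)], []) (Suc (2 * length u + 1)) ?eq"
        proof (rule word_yields_advance)
          show "delta word_machine 4 [f h, g k] = Go 2 [(f h, Right), (g k, Right)] None"
            by (simp add: word_machine_def)
        qed (use IH[of None] in simp)
        moreover have "word_yields (5, [(f, h), (g, k)], []) (Suc (2 * length u + 1)) False"
          by (rule yields_Halt) (simp add: word_machine_def)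
        ultimately have "word_yields (if i \<in> X then p else p', [(f, h), (g, k)], [])
            (Suc (2 * length u + 1)) (i \<in> Y \<and> ?eq)"
          using that(2,3) by (auto split: if_splits)
        then have "word_yields (3, [(f, h), (g, k)], replicate i 1)
            (Suc (Suc (2 * length u + 1))) (i \<in> Y \<and> ?eq)"
          using that(1) by (intro word_yields_Query)
        then show ?thesis
          by (simp add: eval_nat_numeral)
      qed
      have "word_yields (3, [(f, h), (g, k)], replicate i 1) (2 * length u + 3)
          (normal_form X s (x # u) = normal_form X s v)"
      proof -
        consider (b) "x = gb" "y = gb" | (equal) "x = y" "x \<noteq> gb"
          | (cd) "{x, y} = {gc, gd}" | (ce) "{x, y} = {gc, ge}"
          | (different) "x \<noteq> y" "{x, y} \<noteq> {gc, gd}" "{x, y} \<noteq> {gc, ge}"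
          by blast
        then show ?thesis
        proof cases
          case b
          have "word_yields (3, [(f, h), (g, k)], replicate i 1) (Suc (2 * length u + 1))
              (normal_form X (Some (Suc i)) u = normal_form X (Some (Suc i)) v')"
          proof (rule word_yields_advance)
            show "delta word_machine 3 [f h, g k] = Go 3 [(f h, Right), (g k, Right)] (Some 1)"
              by (simp add: f g b word_machine_def)
          qed (use IH[of "Some (Suc i)"] in \<open>simp add: replicate_append_same\<close>)
          then show ?thesis
            by (auto simp: Some v b elim: yields_mono)
        next
          case equal
          have "delta word_machine 3 [f h, g k] = Query 2 2"
            using equal by (cases x) (simp_all add: f g word_machine_def)
          then have "word_yields (3, [(f, h), (g, k)], replicate i 1) (Suc (2 * length u + 2))
              (normal_form X (scan None x) u = normal_form X (scan None x) v')"
            using \<open>x = y \<Longrightarrow> _\<close>[OF equal(1)]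
            by (intro word_yields_Query[where p = 2 and p' = 2]) simp_all
          moreover have "scan (Some i) x = scan None x"
            using equal(2) by (cases x) simp_all
          ultimately show ?thesis
            using equal by (simp add: Some v eval_nat_numeral)
        next
          case cd
          have "delta word_machine 3 [f h, g k] = Query 4 5"
            using cd by (auto simp: f g word_machine_def doubleton_eq_iff)
          from query[OF this, of X] have "word_yields (3, [(f, h), (g, k)], replicate i 1)
              (2 * length u + 3) (i \<in> X \<and> ?eq)"
            by simp
          moreover have "normal_form X s (x # u) = normal_form X s v \<longleftrightarrow> i \<in> X \<and> ?eq"
            using cd by (auto simp: Some v canon_def doubleton_eq_iff)
          ultimately show ?thesis
            by simp
        next
          case ce
          have "delta word_machine 3 [f h, g k] = Query 5 4"
            using ce by (auto simp: f g word_machine_def doubleton_eq_iff)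
          moreover have "- X \<noteq> X"
            by blast
          ultimately have "word_yields (3, [(f, h), (g, k)], replicate i 1)
              (2 * length u + 3) (i \<in> - X \<and> ?eq)"
            by (intro query) simp_all
          moreover have "normal_form X s (x # u) = normal_form X s v \<longleftrightarrow> i \<in> - X \<and> ?eq"
            using ce by (auto simp: Some v canon_def doubleton_eq_iff)
          ultimately show ?thesis
            by simp
        next
          \<comment> \<open>This includes the pair \<open>gd\<close>, \<open>ge\<close>: exactly one
            of them is rewritten to \<open>gc\<close>, so they never agree.\<close>
          case different
          have "delta word_machine 3 [f h, g k] = Halt False"
            using different by (cases x; cases y) (auto simp: f g word_machine_def doubleton_eq_iff)
          then have "word_yields (3, [(f, h), (g, k)], replicate i 1) (2 * length u + 3) False"
            by (intro yields_Halt) simp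
          moreover have "normal_form X s (x # u) \<noteq> normal_form X s v"
            using different by (cases x; cases y) (auto simp: Some v canon_def)
          ultimately show ?thesis
            by simp
        qed
      qed
      then show ?thesis
        by (simp add: Some eval_nat_numeral)
    qed
  qed
qed

text \<open>Copying and rewinding take \<open>length u + 1\<close> steps each, the comparison at
  most \<open>2 * length u + 1\<close>.\<close>

lemma word_machine_yields:
  "word_yields (initial_config word_machine (map gen_code u @ 6 # map gen_code v))
    (4 * length u + 3) (M_elem X u = M_elem X v)"
proof -
  let ?xs = "map gen_code u"
  define n where "n = length u"
  define f where "f = (\<lambda>p. if 0 \<le> p \<and> p < int (length (?xs @ 6 # map gen_code v))
    then (?xs @ 6 # map gen_code v) ! nat p else 0)"
  \<comment> \<open>\<open>g i\<close> is the second tape once \<open>i\<close> letters have been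
    copied.\<close>
  define g where "g = (\<lambda>i p. if 0 \<le> p \<and> p < int i then ?xs ! nat p else 0)"
  have f_less: "f (int i) = gen_code (u ! i)" if "i < n" for i
    using that by (simp add: f_def n_def nth_append)
  have f_eq: "f (int n) = 6"
    by (simp add: f_def n_def nth_append)
  have g_less: "g n (int i) = gen_code (u ! i)" if "i < n" for i
    using that by (simp add: g_def n_def)
  have "reads_from f (int n + 1) (map gen_code v)"
    by (auto simp: reads_from_def f_def n_def nth_append nat_add_distrib)
  moreover have "reads_from (g n) 0 (map gen_code u)"
    by (auto simp: reads_from_def g_def n_def)
  ultimately have compare: "word_yields (2, [(f, int n + 1), (g n, 0)], []) (2 * n + 1)
      (M_elem X u = M_elem X v)"
    using word_machine_compares[of f "int n + 1" v "g n" 0 u None] by (simp add: M_elem_eq_iff n_def)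
  have rewind: "word_yields (1, [(f, int n), (g n, int i - 1)], []) (i + 2 * n + 2)
      (M_elem X u = M_elem X v)" if "i \<le> n" for i
    using that
  proof (induction i)
    case 0
    \<comment> \<open>The head of the copy is on the blank before its first letter; the instruction
      that moves it there also takes the other head from the separator to the second word.\<close>
    have "word_yields (1, [(f, int n), (g n, int 0 - 1)], []) (Suc (2 * n + 1))
        (M_elem X u = M_elem X v)"
    proof (rule word_yields_advance)
      show "delta word_machine 1 [f (int n), g n (int 0 - 1)] =
          Go 2 [(f (int n), Right), (g n (int 0 - 1), Right)] None"
        by (simp add: word_machine_def g_def)
    qed (use compare in simp)
    then show ?case
      by simp
  next
    case (Suc i)
    show ?case
      unfolding add_Suc
    proof (rule word_yields_Go)
      show "delta word_machine 1 [f (int n), g n (int (Suc i) - 1)] =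
          Go 1 [(f (int n), Stay), (g n (int (Suc i) - 1), Left)] None"
        using Suc.prems gen_code_bounds(1)[of "u ! i"] by (simp add: word_machine_def g_less)
    qed (use Suc in simp)
  qed
  have copy: "word_yields (0, [(f, int (n - i)), (g (n - i), int (n - i))], []) (i + 3 * n + 3)
      (M_elem X u = M_elem X v)" if "i \<le> n" for i
    using that
  proof (induction i)
    case 0
    have "word_yields (0, [(f, int n), (g n, int n)], []) (Suc (n + 2 * n + 2))
        (M_elem X u = M_elem X v)"
    proof (rule word_yields_Go)
      show "delta word_machine 0 [f (int n), g n (int n)] =
          Go 1 [(f (int n), Stay), (g n (int n), Left)] None"
        by (simp add: word_machine_def f_eq)
    qed (use rewind[of n] in simp)
    from yields_mono[OF this, of "0 + 3 * n + 3"] show ?case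
      by simp
  next
    case (Suc i)
    let ?j = "n - Suc i"
    have j: "?j < n" "n - i = Suc ?j"
      using Suc.prems by auto
    show ?case
      unfolding add_Suc
    proof (rule word_yields_Go)
      show "delta word_machine 0 [f (int ?j), g ?j (int ?j)] =
          Go 0 [(f (int ?j), Right), (f (int ?j), Right)] None"
        using j(1) gen_code_bounds(2)[of "u ! ?j"] by (simp add: word_machine_def f_less Let_def)
      have "(g ?j)(int ?j := f (int ?j)) = g (Suc ?j)"
        using j(1) by (auto simp: g_def f_less n_def)
      then show "word_yields (0, [tape_act (f (int ?j), Right) (f, int ?j),
          tape_act (f (int ?j), Right) (g ?j, int ?j)],
          [] @ (case None of None \<Rightarrow> [] | Some s \<Rightarrow> [s])) (i + 3 * n + 3) (M_elem X u = M_elem X v)"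
        using Suc.IH Suc.prems unfolding j(2) by (simp add: add.commute)
    qed
  qed
  have "initial_config word_machine (map gen_code u @ 6 # map gen_code v) =
      (0, [(f, 0), (g 0, 0)], [])"
    by (auto simp: initial_config_def input_tape_def blank_tape_def word_machine_def f_def g_def
        intro!: ext)
  with copy[of n] show ?thesis
    by (simp add: n_def add.assoc)
qed

end

theorem proposition4p4:
  fixes X :: "nat set"
  assumes "X \<noteq> {}" and "X \<noteq> UNIV"
  shows "linear_time_Turing_equivalent (word_problem X) (unary_membership_problem X) \<and>
         (decidable (word_problem X) \<longleftrightarrow> recursive_set X)"
proof -
  let ?W = "word_problem X" and ?U = "unary_membership_problem X"
  \<comment> \<open>Both bounds are weakened to the form \<open>k * l + k\<close> with
    \<open>l\<close> the input length: \<open>k = 4\<close> works since the coded pair is longer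
    than its first word, and \<open>k = 7\<close> dominates \<open>2 * n + 7\<close>.\<close>
  have word: "yields word_machine (oracle_for ?U) (range (coding ?U))
      (initial_config word_machine (coding ?W x)) (4 * length (coding ?W x) + 4)
      (x \<in> yes_instances ?W)" for x
    using yields_mono[OF word_machine_yields[of X "fst x" "snd x"],
        of "4 * length (coding ?W x) + 4"]
    by (simp add: word_problem_def split_beta)
  have membership: "yields membership_machine (oracle_for ?W) (range (coding ?W))
      (initial_config membership_machine (coding ?U n)) (7 * length (coding ?U n) + 7)
      (n \<in> yes_instances ?U)" for n
    using yields_mono[OF membership_machine_yields[of X n], of "7 * n + 7"]
    by (simp add: unary_membership_problem_def)
  have admits: "admits_inputs word_machine ?W" "admits_inputs membership_machine ?U"
    using gen_code_bounds less_trans[OF gen_code_bounds(2), of 7]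
    by (auto simp: admits_inputs_def word_problem_def unary_membership_problem_def
        word_machine_def membership_machine_def)
  have "linear_time_reducible ?W ?U"
    unfolding linear_time_reducible_def
    using wf_word_machine admits(1) halts_within_if_yields[OF word] by blast
  moreover have "linear_time_reducible ?U ?W"
    unfolding linear_time_reducible_def
    using wf_membership_machine admits(2) halts_within_if_yields[OF membership] by blast
  moreover have "decidable ?W" if "decidable ?U"
    using wf_word_machine admits(1) _ that by (rule decidable_by_oracle) (use word in blast)
  moreover have "decidable ?U" if "decidable ?W"
    using wf_membership_machine admits(2) _ that by (rule decidable_by_oracle) (use membership in blast)
  ultimately show ?thesis
    by (auto simp: linear_time_Turing_equivalent_def recursive_set_def)
qed

end
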